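(* Let $V$ be a $\mathbb{K}$-vector space and let $*$ and $\{-,-\}$ be two bilinear products on $V$ such that for all $x,y,z\in V$: \begin{align*} (x*y)*z-x*(y*z)&=(x*z)*y-x*(z*y),\\ \{x,y\}&=-\{y,x\},\\ x*\{y,z\}&=\{x*y,z\},\\ \{x,y\}*z&=\{x*z,y\}+\{x,y*z\}+\{\{x,y\},z\}. \end{align*} Define a bilinear product $\bullet$ on $T(V)$ by: for all $m,n\ge 0$ and $x_1,\ldots,x_m,y_1,\ldots,y_n\in V$, \begin{align*} x_1\ldots x_m\bullet y_1\ldots y_n&=\sum_{i=1}^m x_1\ldots x_{i-1}(x_i*y_1)(x_{i+1}\ldots x_m\mathbin{\sqcup\!\sqcup} y_2\ldots y_n)\\ &\quad+\sum_{i=1}^{m-1}x_1\ldots x_{i-1}\{x_i,x_{i+1}\}(x_{i+2}\ldots x_m\mathbin{\sqcup\!\sqcup} y_1\ldots y_n), \end{align*} where the first sum is understood to be $0$ if $n=0$. Then $(T(V),\mathbin{\sqcup\!\sqcup},\bullet,\Delta)$ is a Com-PreLie bialgebra. Moreover, all products $\bullet$ on $T(V)$, homogeneous of degree $-1$ (i.e. $V^{\otimes k}\bullet V^{\otimes l}\subseteq V^{\otimes (k+l-1)}$ for all $k,l\ge0$, with $V^{\otimes p}=(0)$ if $p<0$), such that $(T(V),\mathbin{\sqcup\!\sqcup},\bullet,\Delta)$ is a Com-PreLie bialgebra, are obtained in this way.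
   Context: $\mathbb{K}$ is a field of characteristic zero. $T(V)=\bigoplus_{n\ge0}V^{\otimes n}$; elements are written as words, the empty word is $\emptyset$; juxtaposition is concatenation; $\mathbin{\sqcup\!\sqcup}$ is the shuffle product (with unit $\emptyset$), $\Delta(v_1\ldots v_n)=\sum_{i=0}^n v_1\ldots v_i\otimes v_{i+1}\ldots v_n$ is deconcatenation. A Com-PreLie algebra is a vector space $A$ with bilinear products $\cdot,\bullet$ such that $\cdot$ is associative and commutative, $(a\bullet b)\bullet c-a\bullet(b\bullet c)=(a\bullet c)\bullet b-a\bullet(c\bullet b)$ and $(a\cdot b)\bullet c=(a\bullet c)\cdot b+a\cdot(b\bullet c)$ for all $a,b,c$; it is unitary if $(A,\cdot)$ has a unit. A Com-PreLie bialgebra is $(A,\cdot,\bullet,\Delta)$ with $(A,\cdot,\bullet)$ a unitary Com-PreLie algebra, $(A,\cdot,\Delta)$ a bialgebra, and $\Delta(a\bullet b)=a^{(1)}\otimes a^{(2)}\bullet b+a^{(1)}\bullet b^{(1)}\otimes a^{(2)}\cdot b^{(2)}$ for all $a,b\in A$ (Sweedler notation). *)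

theory Defs
  imports Complex_Main "HOL-Library.Function_Algebras" "HOL-Library.Multiset"
begin

section \<open>Tensor powers and tensor algebras\<close>

text \<open>
  Vector spaces are linear subspaces \<open>A\<close> of a type carrying a \<^locale>\<open>vector_space\<close> structure
  \<open>s\<close>.  The library has no tensor products over an arbitrary field.  The tensor algebra of \<open>A\<close>
  is realised as the linear span of the pure tensors
  \<open>a\<^sub>1 \<otimes> \<dots> \<otimes> a\<^sub>n\<close>, where a pure tensor is the evaluation functional
  \<open>\<phi> \<mapsto> \<phi> [a\<^sub>1, \<dots>, a\<^sub>n]\<close> on the families \<open>\<phi>\<close> of multilinear forms on \<open>A\<^sup>n\<close>, \<open>n \<ge> 0\<close>.  Over a
  field this is the usual tensor algebra; the universal property is proved below
  (\<open>tensor_algebra_universal\<close>).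
\<close>

definition linear_on ::
    "('k \<Rightarrow> 'a::ab_group_add \<Rightarrow> 'a) \<Rightarrow> 'a set \<Rightarrow> ('k \<Rightarrow> 'b::ab_group_add \<Rightarrow> 'b) \<Rightarrow> ('a \<Rightarrow> 'b) \<Rightarrow> bool"
  where "linear_on s A t f \<longleftrightarrow>
    (\<forall>x\<in>A. \<forall>y\<in>A. f (x + y) = f x + f y) \<and> (\<forall>c. \<forall>x\<in>A. f (s c x) = t c (f x))"

definition multilinear ::
    "('k \<Rightarrow> 'a::ab_group_add \<Rightarrow> 'a) \<Rightarrow> 'a set \<Rightarrow> ('k \<Rightarrow> 'b::ab_group_add \<Rightarrow> 'b) \<Rightarrow> ('a list \<Rightarrow> 'b) \<Rightarrow> bool"
  where "multilinear s A t f \<longleftrightarrow>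
    (\<forall>us\<in>lists A. \<forall>vs\<in>lists A. linear_on s A t (\<lambda>x. f (us @ x # vs)))"

definition fscale :: "'k::times \<Rightarrow> ('a \<Rightarrow> 'k) \<Rightarrow> 'a \<Rightarrow> 'k"
  where "fscale c f = (\<lambda>x. c * f x)"

definition tens ::
    "('k::field \<Rightarrow> 'a::ab_group_add \<Rightarrow> 'a) \<Rightarrow> 'a set \<Rightarrow> 'a list \<Rightarrow> ('a list \<Rightarrow> 'k) \<Rightarrow> 'k"
  where "tens s A xs = (\<lambda>\<phi>. if multilinear s A (*) \<phi> then \<phi> xs else 0)"

definition tensor_power ::
    "('k::field \<Rightarrow> 'a::ab_group_add \<Rightarrow> 'a) \<Rightarrow> 'a set \<Rightarrow> nat \<Rightarrow> (('a list \<Rightarrow> 'k) \<Rightarrow> 'k) set"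
  where "tensor_power s A n = module.span fscale (tens s A ` {xs \<in> lists A. length xs = n})"

definition tensor_algebra ::
    "('k::field \<Rightarrow> 'a::ab_group_add \<Rightarrow> 'a) \<Rightarrow> 'a set \<Rightarrow> (('a list \<Rightarrow> 'k) \<Rightarrow> 'k) set"
  where "tensor_algebra s A = module.span fscale (tens s A ` lists A)"

lemma vector_space_fscale: "vector_space (fscale :: 'k::field \<Rightarrow> ('a \<Rightarrow> 'k) \<Rightarrow> 'a \<Rightarrow> 'k)"
  by unfold_locales (auto simp: fscale_def fun_eq_iff algebra_simps)

lemma vector_space_mult: "vector_space ((*) :: 'k::field \<Rightarrow> 'k \<Rightarrow> 'k)"
  by unfold_locales (auto simp: algebra_simps)

lemma multilinear_tens:
  assumes "vector_space s" and A: "module.subspace s A"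
  shows "multilinear s A fscale (tens s A)"
  unfolding multilinear_def linear_on_def
  by (auto simp: fun_eq_iff fscale_def tens_def multilinear_def linear_on_def)

lemma tensor_algebra_lift:
  fixes s :: "'k::field \<Rightarrow> 'a::ab_group_add \<Rightarrow> 'a" and t :: "'k \<Rightarrow> 'b::ab_group_add \<Rightarrow> 'b"
  assumes t: "vector_space t" and f: "multilinear s A t f"
  shows "\<exists>F. Vector_Spaces.linear fscale t F \<and> (\<forall>xs\<in>lists A. F (tens s A xs) = f xs)"
proof -
  interpret P: vector_space_pair "fscale :: 'k \<Rightarrow> (('a list \<Rightarrow> 'k) \<Rightarrow> 'k) \<Rightarrow> _" t
    using vector_space_fscale t by (simp add: vector_space_pair_def)
  interpret Q: vector_space_pair t "(*) :: 'k \<Rightarrow> 'k \<Rightarrow> 'k"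
    using vector_space_mult t by (simp add: vector_space_pair_def)
  obtain B where B: "B \<subseteq> tens s A ` lists A" "P.vs1.independent B"
    "tens s A ` lists A \<subseteq> P.vs1.span B"
    by (rule P.vs1.maximal_independent_subset)
  define r where "r b = (SOME xs. xs \<in> lists A \<and> tens s A xs = b)" for b
  have r: "r b \<in> lists A" "tens s A (r b) = b" if "b \<in> B" for b
    using someI_ex[of "\<lambda>xs. xs \<in> lists A \<and> tens s A xs = b"] B(1) that unfolding r_def by auto
  obtain F where F: "Vector_Spaces.linear fscale t F" "\<And>b. b \<in> B \<Longrightarrow> F b = f (r b)"
    using P.linear_independent_extend[OF B(2), of "\<lambda>b. f (r b)"] by blast
  have "F (tens s A xs) = f xs" if xs: "xs \<in> lists A" for xs
  proof (rule ccontr)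
    define d where "d = F (tens s A xs) - f xs"
    assume "F (tens s A xs) \<noteq> f xs"
    then have "P.vs2.independent {d}" by (simp add: d_def)
    then obtain \<psi> where \<psi>: "Vector_Spaces.linear t (*) \<psi>" "\<psi> d = 1"
      using Q.linear_independent_extend[of "{d}" "\<lambda>_. 1"] by blast
    have ml: "multilinear s A (*) (\<lambda>xs. \<psi> (f xs))"
      using f unfolding multilinear_def linear_on_def
      by (simp add: Q.linear_add[OF \<psi>(1)] Q.linear_scale[OF \<psi>(1)])
    obtain S c where S: "finite S" "S \<subseteq> B" "tens s A xs = (\<Sum>b\<in>S. fscale (c b) b)"
  proof -
    have "tens s A xs \<in> P.vs1.span B" using B(3) xs by blast
    then show ?thesis using that unfolding P.vs1.span_explicit by blast
  qed
    have val: "b (\<lambda>xs. \<psi> (f xs)) = \<psi> (F b)" if "b \<in> S" for b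
    proof -
      have "b (\<lambda>xs. \<psi> (f xs)) = tens s A (r b) (\<lambda>xs. \<psi> (f xs))" using r that S by auto
      then show ?thesis using ml F(2) that S by (auto simp: tens_def)
    qed
    have ev: "(\<Sum>b\<in>S'. g b) \<phi> = (\<Sum>b\<in>S'. g b \<phi>)" if "finite S'" for S' :: "(('a list \<Rightarrow> 'k) \<Rightarrow> 'k) set"
      and g :: "_ \<Rightarrow> ('a list \<Rightarrow> 'k) \<Rightarrow> 'k" and \<phi>
      using that by (induction S' rule: finite_induct) auto
    have "\<psi> (f xs) = tens s A xs (\<lambda>xs. \<psi> (f xs))" using ml by (simp add: tens_def)
    also have "\<dots> = (\<Sum>b\<in>S. c b * b (\<lambda>xs. \<psi> (f xs)))"
      using S ev by (simp add: fscale_def)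
    also have "\<dots> = (\<Sum>b\<in>S. c b * \<psi> (F b))" using val by simp
    also have "\<dots> = \<psi> (F (\<Sum>b\<in>S. fscale (c b) b))"
      by (simp add: P.linear_sum[OF F(1)] P.linear_scale[OF F(1)]
          Q.linear_sum[OF \<psi>(1)] Q.linear_scale[OF \<psi>(1)])
    finally have "\<psi> (f xs) = \<psi> (F (tens s A xs))" using S by simp
    then show False using \<psi> Q.linear_diff[OF \<psi>(1), of "F (tens s A xs)" "f xs"]
      by (simp add: d_def)
  qed
  with F show ?thesis by blast
qed

lemma linear_imp_linear_on: "Vector_Spaces.linear s t F \<Longrightarrow> linear_on s A t F"
  by (simp add: linear_on_def Vector_Spaces.linear_iff)

lemma linear_on_span_eqI:
  assumes "vector_space s" "vector_space t"
    and "linear_on s (module.span s X) t F" "linear_on s (module.span s X) t G"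
    and "\<And>x. x \<in> X \<Longrightarrow> F x = G x" and x: "x \<in> module.span s X"
  shows "F x = G x"
proof -
  interpret S: vector_space s by fact
  interpret T: vector_space t by fact
  have "x \<in> S.span X \<and> F x = G x"
    using x
  proof (induction rule: S.span_induct_alt)
    case base
    have "F (s 0 0) = t 0 (F 0)" "G (s 0 0) = t 0 (G 0)"
      using assms(3,4) S.span_zero[of X] unfolding linear_on_def by blast+
    then show ?case by (simp add: S.span_zero)
  next
    case (step c y z)
    then show ?case using assms(3-5) S.span_base[OF step(1)]
      by (simp add: linear_on_def S.span_add S.span_scale)
  qed
  then show ?thesis ..
qed

theorem tensor_algebra_universal:
  fixes s :: "'k::field \<Rightarrow> 'a::ab_group_add \<Rightarrow> 'a" and t :: "'k \<Rightarrow> 'b::ab_group_add \<Rightarrow> 'b"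
  assumes t: "vector_space t" and f: "multilinear s A t f"
  shows "\<exists>F. linear_on fscale (tensor_algebra s A) t F \<and> (\<forall>xs\<in>lists A. F (tens s A xs) = f xs) \<and>
    (\<forall>G. linear_on fscale (tensor_algebra s A) t G \<and> (\<forall>xs\<in>lists A. G (tens s A xs) = f xs)
      \<longrightarrow> (\<forall>x\<in>tensor_algebra s A. G x = F x))"
proof -
  obtain F where F: "Vector_Spaces.linear fscale t F" "\<forall>xs\<in>lists A. F (tens s A xs) = f xs"
    using tensor_algebra_lift[OF t f] by blast
  show ?thesis
  proof (intro exI[of _ F] conjI allI impI ballI)
    show "linear_on fscale (tensor_algebra s A) t F" using F(1) by (rule linear_imp_linear_on)
  next
    fix G x
    assume G: "linear_on fscale (tensor_algebra s A) t G \<and> (\<forall>xs\<in>lists A. G (tens s A xs) = f xs)"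
      and x: "x \<in> tensor_algebra s A"
    show "G x = F x"
    proof (rule linear_on_span_eqI[OF vector_space_fscale t, where X = "tens s A ` lists A" and F = G and G = F and x = x])
      show "linear_on fscale (module.span fscale (tens s A ` lists A)) t G"
        using G unfolding tensor_algebra_def by blast
      show "linear_on fscale (module.span fscale (tens s A ` lists A)) t F"
        using F(1) by (rule linear_imp_linear_on)
      show "x \<in> module.span fscale (tens s A ` lists A)"
        using x unfolding tensor_algebra_def .
      show "G y = F y" if "y \<in> tens s A ` lists A" for y
        using that G F(2) by (elim imageE) simp
    qed
  qed (use F in auto)
qed


section \<open>Com-PreLie bialgebras\<close>

definition bilinear_product ::
    "('k \<Rightarrow> 'a::ab_group_add \<Rightarrow> 'a) \<Rightarrow> 'a set \<Rightarrow> ('a \<Rightarrow> 'a \<Rightarrow> 'a) \<Rightarrow> bool"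
  where "bilinear_product s A p \<longleftrightarrow>
    (\<forall>a\<in>A. \<forall>b\<in>A. p a b \<in> A) \<and>
    (\<forall>a\<in>A. linear_on s A s (p a)) \<and> (\<forall>b\<in>A. linear_on s A s (\<lambda>a. p a b))"

text \<open>
  \<open>R\<close> is a choice of Sweedler notation for \<open>\<Delta> : A \<rightarrow> A \<otimes> A\<close>: for each \<open>a\<close> it lists pairs
  \<open>(a', a'')\<close> whose tensors add up to \<open>\<Delta> a\<close>.  Here \<open>A \<otimes> A\<close> is \<open>tensor_power s A 2\<close>.
\<close>

definition sweedler ::
    "('k::field \<Rightarrow> 'a::ab_group_add \<Rightarrow> 'a) \<Rightarrow> 'a set \<Rightarrow> ('a \<Rightarrow> ('a list \<Rightarrow> 'k) \<Rightarrow> 'k)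
      \<Rightarrow> ('a \<Rightarrow> ('a \<times> 'a) list) \<Rightarrow> bool"
  where "sweedler s A \<Delta> R \<longleftrightarrow>
    (\<forall>a\<in>A. set (R a) \<subseteq> A \<times> A \<and> \<Delta> a = (\<Sum>(x, y)\<leftarrow>R a. tens s A [x, y]))"

lemma sweedler_exists:
  fixes s :: "'k::field \<Rightarrow> 'a::ab_group_add \<Rightarrow> 'a"
  assumes s: "vector_space s" and A: "module.subspace s A"
    and \<Delta>: "\<forall>a\<in>A. \<Delta> a \<in> tensor_power s A 2"
  shows "\<exists>R. sweedler s A \<Delta> R"
proof -
  interpret F: vector_space "fscale :: 'k \<Rightarrow> (('a list \<Rightarrow> 'k) \<Rightarrow> 'k) \<Rightarrow> _"
    by (rule vector_space_fscale)
  have "\<exists>ps. set ps \<subseteq> A \<times> A \<and> t = (\<Sum>(x, y)\<leftarrow>ps. tens s A [x, y])"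
    if "t \<in> tensor_power s A 2" for t
    using that unfolding tensor_power_def
  proof (induction rule: F.span_induct_alt)
    case base
    show ?case by (rule exI[of _ "[]"]) simp
  next
    case (step c y z)
    obtain ps where ps: "set ps \<subseteq> A \<times> A" "z = (\<Sum>(x, y)\<leftarrow>ps. tens s A [x, y])"
      using step by blast
    obtain u v where uv: "u \<in> A" "v \<in> A" "y = tens s A [u, v]"
      using step(1) by (auto simp: numeral_2_eq_2 length_Suc_conv)
    have "multilinear s A fscale (tens s A)" by (rule multilinear_tens[OF s A])
    then have "tens s A ([] @ s c u # [v]) = fscale c (tens s A ([] @ u # [v]))"
      unfolding multilinear_def linear_on_def
      using uv lists.Nil[of A] lists.Cons[OF uv(2) lists.Nil] by blast
    moreover have "s c u \<in> A"
      using A uv s by (simp add: module.subspace_def vector_space_def module_def module.subspace_scale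
          module_iff_vector_space[symmetric])
    ultimately show ?case
      using ps uv by (intro exI[of _ "(s c u, v) # ps"]) simp
  qed
  then show ?thesis using \<Delta> unfolding sweedler_def by (intro bchoice ballI) auto
qed

locale com_prelie_algebra = vector_space scale
  for scale :: "'k::field_char_0 \<Rightarrow> 'a::ab_group_add \<Rightarrow> 'a" +
  fixes A :: "'a set" and dot bul :: "'a \<Rightarrow> 'a \<Rightarrow> 'a"
  assumes subspace_carrier: "subspace A"
    and bilinear_dot: "bilinear_product scale A dot"
    and bilinear_bul: "bilinear_product scale A bul"
    and dot_assoc: "\<lbrakk>a \<in> A; b \<in> A; c \<in> A\<rbrakk> \<Longrightarrow> dot (dot a b) c = dot a (dot b c)"
    and dot_commute: "\<lbrakk>a \<in> A; b \<in> A\<rbrakk> \<Longrightarrow> dot a b = dot b a"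
    and prelie: "\<lbrakk>a \<in> A; b \<in> A; c \<in> A\<rbrakk> \<Longrightarrow>
      bul (bul a b) c - bul a (bul b c) = bul (bul a c) b - bul a (bul c b)"
    and leibniz: "\<lbrakk>a \<in> A; b \<in> A; c \<in> A\<rbrakk> \<Longrightarrow>
      bul (dot a b) c = dot (bul a c) b + dot a (bul b c)"

definition is_unit_of :: "'a set \<Rightarrow> ('a \<Rightarrow> 'a \<Rightarrow> 'a) \<Rightarrow> 'a \<Rightarrow> bool"
  where "is_unit_of A dot e \<longleftrightarrow> e \<in> A \<and> (\<forall>a\<in>A. dot e a = a \<and> dot a e = a)"

locale unitary_com_prelie_algebra = com_prelie_algebra +
  assumes unitary: "\<exists>e. is_unit_of A dot e"

definition is_counit ::
    "('k::field \<Rightarrow> 'a::ab_group_add \<Rightarrow> 'a) \<Rightarrow> 'a set \<Rightarrow> ('a \<Rightarrow> ('a list \<Rightarrow> 'k) \<Rightarrow> 'k)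
      \<Rightarrow> ('a \<Rightarrow> 'k) \<Rightarrow> bool"
  where "is_counit s A \<Delta> \<epsilon> \<longleftrightarrow> linear_on s A (*) \<epsilon> \<and>
    (\<forall>R. sweedler s A \<Delta> R \<longrightarrow>
      (\<forall>a\<in>A. (\<Sum>(x, y)\<leftarrow>R a. s (\<epsilon> x) y) = a \<and> (\<Sum>(x, y)\<leftarrow>R a. s (\<epsilon> y) x) = a))"

text \<open>
  Unit and counit are unique, so as usual they are not part of the signature.
  In \<open>coassoc\<close>, \<open>x \<otimes> y\<close> runs through \<open>\<Delta> a\<close> and \<open>u \<otimes> v\<close> through \<open>\<Delta> x\<close>, respectively \<open>\<Delta> y\<close>.
\<close>

locale bialgebra = vector_space scale
  for scale :: "'k::field \<Rightarrow> 'a::ab_group_add \<Rightarrow> 'a" +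
  fixes A :: "'a set" and dot :: "'a \<Rightarrow> 'a \<Rightarrow> 'a" and \<Delta> :: "'a \<Rightarrow> ('a list \<Rightarrow> 'k) \<Rightarrow> 'k"
  assumes subspace_carrier: "subspace A"
    and bilinear_dot: "bilinear_product scale A dot"
    and dot_assoc: "\<lbrakk>a \<in> A; b \<in> A; c \<in> A\<rbrakk> \<Longrightarrow> dot (dot a b) c = dot a (dot b c)"
    and coproduct_closed: "a \<in> A \<Longrightarrow> \<Delta> a \<in> tensor_power scale A 2"
    and coproduct_linear: "linear_on scale A fscale \<Delta>"
    and coassoc: "\<lbrakk>sweedler scale A \<Delta> R; a \<in> A\<rbrakk> \<Longrightarrow>
      (\<Sum>(x, y)\<leftarrow>R a. \<Sum>(u, v)\<leftarrow>R x. tens scale A [u, v, y]) =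
      (\<Sum>(x, y)\<leftarrow>R a. \<Sum>(u, v)\<leftarrow>R y. tens scale A [x, u, v])"
    and coproduct_mult: "\<lbrakk>sweedler scale A \<Delta> R; a \<in> A; b \<in> A\<rbrakk> \<Longrightarrow>
      \<Delta> (dot a b) = (\<Sum>(a1, a2)\<leftarrow>R a. \<Sum>(b1, b2)\<leftarrow>R b. tens scale A [dot a1 b1, dot a2 b2])"
    and unit_counit: "\<exists>e \<epsilon>. is_unit_of A dot e \<and> is_counit scale A \<Delta> \<epsilon> \<and>
      \<Delta> e = tens scale A [e, e] \<and> \<epsilon> e = 1 \<and> (\<forall>a\<in>A. \<forall>b\<in>A. \<epsilon> (dot a b) = \<epsilon> a * \<epsilon> b)"

locale com_prelie_bialgebra =
  unitary_com_prelie_algebra scale A dot bul + bialgebra scale A dot \<Delta>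
  for scale :: "'k::field_char_0 \<Rightarrow> 'a::ab_group_add \<Rightarrow> 'a" and A dot bul \<Delta> +
  assumes coproduct_bul: "\<lbrakk>sweedler scale A \<Delta> R; a \<in> A; b \<in> A\<rbrakk> \<Longrightarrow>
    \<Delta> (bul a b) = (\<Sum>(a1, a2)\<leftarrow>R a. tens scale A [a1, bul a2 b]) +
      (\<Sum>(a1, a2)\<leftarrow>R a. \<Sum>(b1, b2)\<leftarrow>R b. tens scale A [bul a1 b1, dot a2 b2])"


section \<open>The operations on the tensor algebra of a vector space\<close>

text \<open>
  From here on the vector space is \<open>V = UNIV\<close>, with scalar multiplication \<open>s\<close>; \<open>tword s [x\<^sub>1, \<dots>, x\<^sub>n]\<close>
  is the word \<open>x\<^sub>1 \<dots> x\<^sub>n\<close>.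
\<close>

abbreviation TV :: "('k::field \<Rightarrow> 'v::ab_group_add \<Rightarrow> 'v) \<Rightarrow> (('v list \<Rightarrow> 'k) \<Rightarrow> 'k) set"
  where "TV s \<equiv> tensor_algebra s UNIV"

abbreviation tword ::
    "('k::field \<Rightarrow> 'v::ab_group_add \<Rightarrow> 'v) \<Rightarrow> 'v list \<Rightarrow> ('v list \<Rightarrow> 'k) \<Rightarrow> 'k"
  where "tword s xs \<equiv> tens s UNIV xs"

text \<open>
  The linear extension to \<open>T(V)\<close> of a multilinear map defined on words; by
  \<open>tensor_algebra_universal\<close> it exists and is unique on \<open>T(V)\<close>.
\<close>

definition lin_ext ::
    "('k::field \<Rightarrow> 'v::ab_group_add \<Rightarrow> 'v) \<Rightarrow> ('k \<Rightarrow> 'w::ab_group_add \<Rightarrow> 'w) \<Rightarrow> ('v list \<Rightarrow> 'w)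
      \<Rightarrow> (('v list \<Rightarrow> 'k) \<Rightarrow> 'k) \<Rightarrow> 'w"
  where "lin_ext s t f =
    (SOME F. linear_on fscale (TV s) t F \<and> (\<forall>xs. F (tword s xs) = f xs))"

text \<open>The terms of \<open>x\<^sub>1 \<dots> x\<^sub>m \<squnion>\<squnion> y\<^sub>1 \<dots> y\<^sub>n\<close> with multiplicity (the library's \<^const>\<open>shuffles\<close> is a set).\<close>

fun shuf :: "'v list \<Rightarrow> 'v list \<Rightarrow> 'v list list" where
  "shuf [] ys = [ys]"
| "shuf xs [] = [xs]"
| "shuf (x # xs) (y # ys) = map (Cons x) (shuf xs (y # ys)) @ map (Cons y) (shuf (x # xs) ys)"

definition shuffle_prod ::
    "('k::field \<Rightarrow> 'v::ab_group_add \<Rightarrow> 'v) \<Rightarrow> (('v list \<Rightarrow> 'k) \<Rightarrow> 'k) \<Rightarrow> (('v list \<Rightarrow> 'k) \<Rightarrow> 'k)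
      \<Rightarrow> ('v list \<Rightarrow> 'k) \<Rightarrow> 'k"
  where "shuffle_prod s t u =
    lin_ext s fscale (\<lambda>xs. lin_ext s fscale (\<lambda>ys. \<Sum>w\<leftarrow>shuf xs ys. tword s w) u) t"

text \<open>The values lie in \<open>T(V) \<otimes> T(V)\<close>, i.e. in \<open>tensor_power fscale (TV s) 2\<close>.\<close>

definition deconc ::
    "('k::field \<Rightarrow> 'v::ab_group_add \<Rightarrow> 'v) \<Rightarrow> (('v list \<Rightarrow> 'k) \<Rightarrow> 'k)
      \<Rightarrow> ((('v list \<Rightarrow> 'k) \<Rightarrow> 'k) list \<Rightarrow> 'k) \<Rightarrow> 'k"
  where "deconc s = lin_ext s fscale
    (\<lambda>xs. \<Sum>i\<le>length xs. tens fscale (TV s) [tword s (take i xs), tword s (drop i xs)])"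

text \<open>
  Indices are shifted by one: \<open>xs ! i\<close> is \<open>x\<^bsub>i+1\<^esub>\<close>.  The second sum is empty for \<open>m = 0\<close>, since
  then \<open>length xs - 1 = 0\<close>.
\<close>

definition bullet_words ::
    "('k::field \<Rightarrow> 'v::ab_group_add \<Rightarrow> 'v) \<Rightarrow> ('v \<Rightarrow> 'v \<Rightarrow> 'v) \<Rightarrow> ('v \<Rightarrow> 'v \<Rightarrow> 'v)
      \<Rightarrow> 'v list \<Rightarrow> 'v list \<Rightarrow> ('v list \<Rightarrow> 'k) \<Rightarrow> 'k"
  where "bullet_words s star brk xs ys =
    (if ys = [] then 0
     else \<Sum>i<length xs. \<Sum>w\<leftarrow>shuf (drop (i + 1) xs) (tl ys).
       tword s (take i xs @ star (xs ! i) (hd ys) # w)) +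
    (\<Sum>i<length xs - 1. \<Sum>w\<leftarrow>shuf (drop (i + 2) xs) ys.
       tword s (take i xs @ brk (xs ! i) (xs ! (i + 1)) # w))"

definition bullet ::
    "('k::field \<Rightarrow> 'v::ab_group_add \<Rightarrow> 'v) \<Rightarrow> ('v \<Rightarrow> 'v \<Rightarrow> 'v) \<Rightarrow> ('v \<Rightarrow> 'v \<Rightarrow> 'v)
      \<Rightarrow> (('v list \<Rightarrow> 'k) \<Rightarrow> 'k) \<Rightarrow> (('v list \<Rightarrow> 'k) \<Rightarrow> 'k) \<Rightarrow> ('v list \<Rightarrow> 'k) \<Rightarrow> 'k"
  where "bullet s star brk t u =
    lin_ext s fscale (\<lambda>xs. lin_ext s fscale (\<lambda>ys. bullet_words s star brk xs ys) u) t"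

definition compatible_products ::
    "('k \<Rightarrow> 'v::ab_group_add \<Rightarrow> 'v) \<Rightarrow> ('v \<Rightarrow> 'v \<Rightarrow> 'v) \<Rightarrow> ('v \<Rightarrow> 'v \<Rightarrow> 'v) \<Rightarrow> bool"
  where "compatible_products s star brk \<longleftrightarrow>
    bilinear_product s UNIV star \<and> bilinear_product s UNIV brk \<and>
    (\<forall>x y z. star (star x y) z - star x (star y z) = star (star x z) y - star x (star z y)) \<and>
    (\<forall>x y. brk x y = - brk y x) \<and>
    (\<forall>x y z. star x (brk y z) = brk (star x y) z) \<and>
    (\<forall>x y z. star (brk x y) z = brk (star x z) y + brk x (star y z) + brk (brk x y) z)"

definition homogeneous_minus_one ::
    "('k::field \<Rightarrow> 'v::ab_group_add \<Rightarrow> 'v)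
      \<Rightarrow> ((('v list \<Rightarrow> 'k) \<Rightarrow> 'k) \<Rightarrow> (('v list \<Rightarrow> 'k) \<Rightarrow> 'k) \<Rightarrow> ('v list \<Rightarrow> 'k) \<Rightarrow> 'k) \<Rightarrow> bool"
  where "homogeneous_minus_one s b \<longleftrightarrow>
    (\<forall>k l. \<forall>t\<in>tensor_power s UNIV k. \<forall>u\<in>tensor_power s UNIV l.
      b t u \<in> (if k + l = 0 then {0} else tensor_power s UNIV (k + l - 1)))"


section \<open>The operations on words\<close>

text \<open>The expressions extended by \<open>lin_ext\<close> above are multilinear, so the defining formulas hold.\<close>

lemma lin_ext:
  fixes s :: "'k::field \<Rightarrow> 'v::ab_group_add \<Rightarrow> 'v"
  assumes "vector_space t" "multilinear s UNIV t f"
  shows lin_ext_linear: "linear_on fscale (TV s) t (lin_ext s t f)"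
    and lin_ext_tword: "lin_ext s t f (tword s xs) = f xs"
proof -
  have "\<exists>F. linear_on fscale (TV s) t F \<and> (\<forall>xs. F (tword s xs) = f xs)"
    using tensor_algebra_universal[OF assms] by auto
  from someI_ex[OF this] show "linear_on fscale (TV s) t (lin_ext s t f)"
    "lin_ext s t f (tword s xs) = f xs"
    unfolding lin_ext_def by auto
qed

context
  fixes s :: "'k::field \<Rightarrow> 'v::ab_group_add \<Rightarrow> 'v" and t :: "'k \<Rightarrow> 'w::ab_group_add \<Rightarrow> 'w"
  assumes s: "vector_space s" and t: "vector_space t"
begin

interpretation T: vector_space t by (rule t)
interpretation S: vector_space s by (rule s)

lemma linear_on_add:
  "linear_on s UNIV t f \<Longrightarrow> linear_on s UNIV t g \<Longrightarrow> linear_on s UNIV t (\<lambda>z. f z + g z)"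
  by (simp add: linear_on_def T.scale_right_distrib)

lemma linear_on_zero: "linear_on s UNIV t (\<lambda>z. 0)"
  by (simp add: linear_on_def)

lemma linear_on_sum_list:
  "(\<And>w. linear_on s UNIV t (\<lambda>z. f z w)) \<Longrightarrow> linear_on s UNIV t (\<lambda>z. \<Sum>w\<leftarrow>ws. f z w)"
  by (induction ws) (simp_all add: linear_on_add linear_on_zero)

lemma linear_on_sum:
  "(\<And>i. i \<in> I \<Longrightarrow> linear_on s UNIV t (\<lambda>z. f z i)) \<Longrightarrow> linear_on s UNIV t (\<lambda>z. \<Sum>i\<in>I. f z i)"
  by (induction I rule: infinite_finite_induct) (simp_all add: linear_on_add linear_on_zero)

lemma multilinear_UNIV:
  "multilinear s UNIV t g \<longleftrightarrow> (\<forall>us vs. linear_on s UNIV t (\<lambda>x. g (us @ x # vs)))"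
  by (simp add: multilinear_def)

lemma multilinear_Cons: "multilinear s UNIV t g \<Longrightarrow> multilinear s UNIV t (\<lambda>w. g (u # w))"
  unfolding multilinear_UNIV
proof (intro allI)
  fix us vs assume "\<forall>us vs. linear_on s UNIV t (\<lambda>x. g (us @ x # vs))"
  from this[rule_format, of "u # us" vs] show "linear_on s UNIV t (\<lambda>x. g (u # us @ x # vs))"
    by simp
qed

lemma multilinear_hd: "multilinear s UNIV t g \<Longrightarrow> linear_on s UNIV t (\<lambda>z. g (z # vs))"
  unfolding multilinear_UNIV by (drule spec[of _ "[]"]) simp

lemma multilinear_hd_compose:
  assumes "multilinear s UNIV t g" "linear_on s UNIV s h"
  shows "linear_on s UNIV t (\<lambda>z. g (h z # vs))"
  using multilinear_hd[OF assms(1), of vs] assms(2) by (simp add: linear_on_def)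

lemma sum_shuf_commute: "(\<Sum>w\<leftarrow>shuf xs ys. (g w :: 'w)) = (\<Sum>w\<leftarrow>shuf ys xs. g w)"
proof -
  have "mset (shuf xs ys) = mset (shuf ys xs)"
  proof (induction xs ys rule: shuf.induct)
    case (1 ys)
    show ?case by (cases ys) auto
  next
    case (3 x xs y ys)
    have "mset (shuf (x # xs) (y # ys)) =
        image_mset (Cons x) (mset (shuf xs (y # ys))) + image_mset (Cons y) (mset (shuf (x # xs) ys))"
      by simp
    also have "\<dots> =
        image_mset (Cons x) (mset (shuf (y # ys) xs)) + image_mset (Cons y) (mset (shuf ys (x # xs)))"
      unfolding 3 ..
    also have "\<dots> = mset (shuf (y # ys) (x # xs))"
      by (simp add: add.commute)
    finally show ?case .
  qed simp
  then show ?thesis by (metis mset_map sum_mset_sum_list)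
qed

lemma linear_shuf_right:
  "multilinear s UNIV t g \<Longrightarrow> linear_on s UNIV t (\<lambda>z. \<Sum>w\<leftarrow>shuf xs (us @ z # vs). g w)"
proof (induction "length xs + length us" arbitrary: xs us g rule: less_induct)
  case less
  show ?case
  proof (cases xs)
    case Nil
    then show ?thesis using less.prems by (simp add: multilinear_UNIV)
  next
    case (Cons x xs')
    have 1: "linear_on s UNIV t (\<lambda>z. \<Sum>w\<leftarrow>shuf xs' (us @ z # vs). g (x # w))"
      using less.hyps[of xs' us "\<lambda>w. g (x # w)"] Cons less.prems by (simp add: multilinear_Cons)
    show ?thesis
    proof (cases us)
      case Nil
      have "linear_on s UNIV t (\<lambda>z. \<Sum>w\<leftarrow>shuf xs vs. g (z # w))"
        by (intro linear_on_sum_list multilinear_hd less.prems)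
      from linear_on_add[OF 1 this] show ?thesis using Cons Nil by (simp add: comp_def)
    next
      case (Cons u us')
      have "linear_on s UNIV t (\<lambda>z. \<Sum>w\<leftarrow>shuf xs (us' @ z # vs). g (u # w))"
        using less.hyps[of xs us' "\<lambda>w. g (u # w)"] Cons less.prems by (simp add: multilinear_Cons)
      from linear_on_add[OF 1 this] show ?thesis using Cons \<open>xs = x # xs'\<close> by (simp add: comp_def)
    qed
  qed
qed

lemma linear_shuf_left:
  "multilinear s UNIV t g \<Longrightarrow> linear_on s UNIV t (\<lambda>z. \<Sum>w\<leftarrow>shuf (us @ z # vs) ys. g w)"
  using linear_shuf_right[of g ys us vs] by (simp add: sum_shuf_commute[of g _ ys])

lemma linear_star_left:
  assumes "\<And>y. linear_on s UNIV s (\<lambda>x. star x y)"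
  shows "multilinear s UNIV t g \<Longrightarrow> linear_on s UNIV t (\<lambda>z.
    \<Sum>i<length (us @ z # vs). \<Sum>w\<leftarrow>shuf (drop (i + 1) (us @ z # vs)) ys.
      g (take i (us @ z # vs) @ star ((us @ z # vs) ! i) y # w))"
proof (induction us arbitrary: g)
  case Nil
  have "linear_on s UNIV t (\<lambda>z. \<Sum>w\<leftarrow>shuf vs ys. g (star z y # w))"
    by (intro linear_on_sum_list multilinear_hd_compose[OF Nil assms])
  moreover have "linear_on s UNIV t (\<lambda>z. \<Sum>i<length vs. \<Sum>w\<leftarrow>shuf (drop (i + 1) vs) ys.
      g (z # take i vs @ star (vs ! i) y # w))"
    by (intro linear_on_sum linear_on_sum_list multilinear_hd[OF Nil])
  ultimately show ?case
    unfolding append_Nil length_Cons sum.lessThan_Suc_shift by (simp add: linear_on_add)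
next
  case (Cons u us)
  have "linear_on s UNIV t (\<lambda>z. \<Sum>w\<leftarrow>shuf (us @ z # vs) ys. g (star u y # w))"
    by (intro linear_shuf_left multilinear_Cons[OF Cons.prems])
  with Cons.IH[OF multilinear_Cons[OF Cons.prems, of u]] show ?case
    unfolding append_Cons length_Cons sum.lessThan_Suc_shift by (simp add: linear_on_add)
qed

lemma linear_brk_left:
  assumes l: "\<And>y. linear_on s UNIV s (\<lambda>x. brk x y)" and r: "\<And>x. linear_on s UNIV s (brk x)"
  shows "multilinear s UNIV t g \<Longrightarrow> linear_on s UNIV t (\<lambda>z.
    \<Sum>i<length (us @ z # vs) - 1. \<Sum>w\<leftarrow>shuf (drop (i + 2) (us @ z # vs)) ys.
      g (take i (us @ z # vs) @ brk ((us @ z # vs) ! i) ((us @ z # vs) ! (i + 1)) # w))"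
proof (induction us arbitrary: g)
  case Nil
  note prems = Nil
  show ?case
  proof (cases vs)
    case Nil
    then show ?thesis by (simp add: linear_on_zero)
  next
    case (Cons v vs')
    have "linear_on s UNIV t (\<lambda>z. \<Sum>w\<leftarrow>shuf vs' ys. g (brk z v # w))"
      by (intro linear_on_sum_list multilinear_hd_compose[OF prems l])
    moreover have "linear_on s UNIV t (\<lambda>z. \<Sum>i<length vs'. \<Sum>w\<leftarrow>shuf (drop (i + 1) vs') ys.
        g (z # take i vs @ brk (vs ! i) (vs' ! i) # w))"
      by (intro linear_on_sum linear_on_sum_list multilinear_hd[OF prems])
    ultimately show ?thesis
      by (simp add: Cons sum.lessThan_Suc_shift linear_on_add del: sum.lessThan_Suc)
  qed
next
  case (Cons u us)
  show ?case
  proof (cases us)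
    case Nil
    have "linear_on s UNIV t (\<lambda>z. \<Sum>w\<leftarrow>shuf vs ys. g (brk u z # w))"
      by (intro linear_on_sum_list multilinear_hd_compose[OF Cons.prems r])
    with Cons.IH[OF multilinear_Cons[OF Cons.prems, of u]] show ?thesis
      by (simp add: Nil sum.lessThan_Suc_shift linear_on_add del: sum.lessThan_Suc)
  next
    case us: (Cons v us')
    have "linear_on s UNIV t (\<lambda>z. \<Sum>w\<leftarrow>shuf (us' @ z # vs) ys. g (brk u v # w))"
      by (intro linear_shuf_left multilinear_Cons[OF Cons.prems])
    with Cons.IH[OF multilinear_Cons[OF Cons.prems, of u]] show ?thesis
      by (simp add: us sum.lessThan_Suc_shift linear_on_add del: sum.lessThan_Suc)
  qed
qed

end

context
  fixes s :: "'k::field \<Rightarrow> 'v::ab_group_add \<Rightarrow> 'v"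
  assumes s: "vector_space s"
begin

lemma multilinear_tword: "multilinear s UNIV fscale (tens s UNIV)"
  using multilinear_tens[OF s] s
  by (simp add: module.subspace_UNIV module_iff_vector_space)

lemma shuffle_prod_tword:
  "shuffle_prod s (tword s xs) (tword s ys) = (\<Sum>w\<leftarrow>shuf xs ys. tword s w)"
proof -
  have 1: "lin_ext s fscale (\<lambda>ys. \<Sum>w\<leftarrow>shuf xs ys. tword s w) (tword s ys) =
      (\<Sum>w\<leftarrow>shuf xs ys. tword s w)" for xs ys
    by (intro lin_ext_tword vector_space_fscale)
      (simp add: multilinear_def linear_shuf_right[OF s vector_space_fscale multilinear_tword])
  show ?thesis
    unfolding shuffle_prod_def 1
    by (intro lin_ext_tword vector_space_fscale)
      (simp add: multilinear_def linear_shuf_left[OF s vector_space_fscale multilinear_tword])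
qed

lemma bullet_tword:
  assumes star: "bilinear_product s UNIV star" and brk: "bilinear_product s UNIV brk"
  shows "bullet s star brk (tword s xs) (tword s ys) = bullet_words s star brk xs ys"
proof -
  note F = s vector_space_fscale
  have star': "linear_on s UNIV s (\<lambda>x. star x y)" "linear_on s UNIV s (star y)"
    and brk': "linear_on s UNIV s (\<lambda>x. brk x y)" "linear_on s UNIV s (brk y)" for y
    using star brk by (simp_all add: bilinear_product_def)
  have append: "multilinear s UNIV fscale (\<lambda>w. tword s (us @ w))" for us
    using multilinear_tword unfolding multilinear_def by (simp flip: append_assoc)
  have "linear_on s UNIV fscale (\<lambda>z. bullet_words s star brk xs (us @ z # vs))" for xs us vs
  proof -
    have "linear_on s UNIV fscale (\<lambda>z. \<Sum>w\<leftarrow>shuf (drop (i + 1) xs) (tl (us @ z # vs)).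
        tword s (take i xs @ star (xs ! i) (hd (us @ z # vs)) # w))" for i
    proof (cases us)
      case Nil
      show ?thesis unfolding Nil
        by (simp, intro linear_on_sum_list[OF F] multilinear_hd_compose[OF F append star'(2)])
    next
      case (Cons u us')
      show ?thesis unfolding Cons
        by (simp, intro linear_shuf_right[OF F] multilinear_Cons[OF F append])
    qed
    moreover have "linear_on s UNIV fscale (\<lambda>z. \<Sum>w\<leftarrow>shuf (drop (i + 2) xs) (us @ z # vs).
        tword s (take i xs @ brk (xs ! i) (xs ! (i + 1)) # w))" for i
      by (intro linear_shuf_right[OF F] multilinear_Cons[OF F append])
    ultimately show ?thesis
      unfolding bullet_words_def by (simp add: linear_on_add[OF F] linear_on_sum[OF F])
  qed
  then have 1: "lin_ext s fscale (\<lambda>ys. bullet_words s star brk xs ys) (tword s ys) =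
      bullet_words s star brk xs ys" for xs ys
    by (intro lin_ext_tword vector_space_fscale) (simp add: multilinear_def)
  have "linear_on s UNIV fscale (\<lambda>z. bullet_words s star brk (us @ z # vs) ys)" for us vs
    unfolding bullet_words_def
    using linear_star_left[OF F, where star = star and g = "tens s UNIV" and us = us and vs = vs
          and ys = "tl ys" and y = "hd ys", OF star'(1) multilinear_tword]
      linear_brk_left[OF F brk' multilinear_tword, where us = us and vs = vs and ys = ys]
    by (cases "ys = []") (simp_all only: simp_thms if_True if_False add_0 linear_on_add[OF F])
  then show ?thesis
    unfolding bullet_def 1
    by (intro lin_ext_tword vector_space_fscale) (simp add: multilinear_def)
qed

lemma deconc_tword:
  "deconc s (tword s xs) =
    (\<Sum>i\<le>length xs. tens fscale (TV s) [tword s (take i xs), tword s (drop i xs)])"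
proof -
  note F = s vector_space_fscale
  interpret T: vector_space "fscale :: 'k \<Rightarrow> (('v list \<Rightarrow> 'k) \<Rightarrow> 'k) \<Rightarrow> _"
    by (rule vector_space_fscale)
  have in_TV: "tword s w \<in> TV s" for w
    unfolding tensor_algebra_def by (intro T.span_base) simp
  have ml: "multilinear fscale (TV s) fscale (tens fscale (TV s))"
    unfolding tensor_algebra_def by (intro multilinear_tens vector_space_fscale) simp
  have left: "linear_on fscale (TV s) fscale (\<lambda>x. tens fscale (TV s) [x, b])"
    and right: "linear_on fscale (TV s) fscale (\<lambda>x. tens fscale (TV s) [b, x])"
    if "b \<in> TV s" for b
    using ml[unfolded multilinear_def, rule_format, of "[]" "[b]"]
      ml[unfolded multilinear_def, rule_format, of "[b]" "[]"] that by simp_all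
  have word: "linear_on s UNIV fscale (\<lambda>z. tword s (us @ z # vs))" for us vs
    using multilinear_tword by (simp add: multilinear_def)
  have comp: "linear_on s UNIV fscale (\<lambda>z. G (tword s (us @ z # vs)))"
    if "linear_on fscale (TV s) fscale G"
    for G :: "_ \<Rightarrow> ((('v list \<Rightarrow> 'k) \<Rightarrow> 'k) list \<Rightarrow> 'k) \<Rightarrow> 'k" and us vs
    using that word[of us vs] in_TV unfolding linear_on_def by simp
  have "linear_on s UNIV fscale (\<lambda>z. \<Sum>i\<le>length (us @ z # vs).
      tens fscale (TV s) [tword s (take i (us @ z # vs)), tword s (drop i (us @ z # vs))])" for us vs
  proof -
    have "linear_on s UNIV fscale (\<lambda>z.
      tens fscale (TV s) [tword s (take i (us @ z # vs)), tword s (drop i (us @ z # vs))])" for i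
    proof (cases "i \<le> length us")
      case True
      then show ?thesis using comp[OF right[OF in_TV]] by simp
    next
      case False
      then obtain j where "i - length us = Suc j" by (metis diff_is_0_eq not0_implies_Suc)
      then show ?thesis using comp[OF left[OF in_TV]] False by simp
    qed
    then show ?thesis by (simp add: linear_on_sum[OF F] del: sum.atMost_Suc)
  qed
  then show ?thesis
    unfolding deconc_def by (intro lin_ext_tword vector_space_fscale) (simp add: multilinear_def)
qed

end

end

(*
  Everything is reduced to words.  On words the product satisfies the recursion
    x u . b = x (u . b) + (x * y) (b' sh u) + {x, z} (u' sh b)    for b = y b', u = z u',
  where a term is absent if its word is empty.  The Leibniz rule, the pre-Lie identity and the
  compatibility with the coproduct follow from it by induction on the left word; the four axioms
  are what makes the terms that do not cancel symmetric.

  For the converse put x * y := x . y and {x, y} := (x y) . 1.  An element c without constant term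
  is the sum of (first letter of c') c'' over its deconcatenation c' (x) c''.  Applied to
  c = (x u) . b, homogeneity leaves in the formula for the coproduct of c only the terms of the
  recursion above.  The axioms are then the pre-Lie and Leibniz identities in low degree.
*)

theory Submission
  imports Defs
begin

text \<open>Two obstacles shape the proof. First, tensors are functionals, and the linear extensions
  are specified on \<open>TV s\<close> only. Composing with a projection makes every operation a
  total linear map that factors through \<open>tproj\<close>, so identities become equations of
  functions that can be tested on words. Second, the coproduct takes values in a tensor square
  accessed through its universal property, and the axioms quantify over all Sweedler
  representatives. The proof therefore works with bilinear test maps \<open>g\<close> into an
  arbitrary space: \<open>D t g\<close> is the composite of the coproduct with \<open>g\<close>.
  Since identities for \<open>D\<close> hold for every \<open>g\<close>, an induction on words can
  pass to the test map \<open>g (L x p) q\<close> when a letter x is split off. The choice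
  \<open>tens2\<close> for \<open>g\<close> gives back the axioms; the choice (first letter of p) q
  drives the converse. There, degrees alone do not exclude a constant term in x . 1; the counit,
  applied to both factors of the coproduct, does.\<close>

text \<open>
  Elements of \<open>T(V)\<close> are themselves functions; as simplification rules the following two facts
  expand eta-long sums of them pointwise.
\<close>

declare plus_fun_apply [simp del] zero_fun_apply [simp del]

section \<open>Sums over deconcatenations of a word\<close>

text \<open>Splitting off the first letter replaces \<open>g\<close> by a summand that prepends
  \<open>x\<close> to the left part. This is why inductions over \<open>cut\<close> generalise over
  \<open>g\<close>, and it mirrors the rule for the coproduct of \<open>L x p\<close>.\<close>

fun cut :: "('a list \<Rightarrow> 'a list \<Rightarrow> 'b::ab_group_add) \<Rightarrow> 'a list \<Rightarrow> 'b" where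
  "cut g [] = g [] []"
| "cut g (x # w) = g [] (x # w) + cut (\<lambda>u v. g (x # u) v) w"

lemma cut_eq_sum: "cut g w = (\<Sum>i\<le>length w. g (take i w) (drop i w))"
  by (induction w arbitrary: g) (simp_all add: sum.atMost_Suc_shift del: sum.atMost_Suc)

lemma cut_add: "cut (\<lambda>u v. g u v + h u v) w = cut g w + cut h w"
  by (induction w arbitrary: g h) simp_all

lemma cut_zero: "cut (\<lambda>u v. 0) w = 0"
  by (induction w) simp_all

lemma cut_left:
  assumes "\<And>x u v. g (x # u) v = 0"
  shows "cut g w = g [] w"
proof (cases w)
  case (Cons x w')
  have "(\<lambda>u. g (x # u)) = (\<lambda>u v. 0)" using assms by (simp add: fun_eq_iff)
  then show ?thesis by (simp add: Cons cut_zero)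
qed simp

lemma cut_right:
  "(\<And>u x v. g u (x # v) = 0) \<Longrightarrow> cut g w = g w []"
  by (induction w arbitrary: g) simp_all

text \<open>Both sides sum \<open>g\<close> over all factorisations of \<open>w\<close> into three
  parts, grouped by the second cut on the left and by the first cut on the right.\<close>

lemma cut_coassoc:
  "cut (\<lambda>p q. cut (\<lambda>u v. g u v q) p) w = cut (\<lambda>p q. cut (\<lambda>u v. g p u v) q) w"
  by (induction w arbitrary: g) (simp_all add: cut_add add.assoc)

lemma cut_swap:
  "cut (\<lambda>p q. cut (\<lambda>u v. g p q u v) w) z = cut (\<lambda>u v. cut (\<lambda>p q. g p q u v) z) w"
  by (induction z arbitrary: g) (simp_all add: cut_add)

section \<open>Shuffle bialgebra\<close>

lemma linear_on_apply_sum_list: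
  assumes "linear_on s UNIV t F" "vector_space t"
  shows "F (\<Sum>x\<leftarrow>xs. g x) = (\<Sum>x\<leftarrow>xs. F (g x))"
proof -
  interpret t: vector_space t by fact
  have z: "F 0 = 0"
    using assms(1)[unfolded linear_on_def] by (metis UNIV_I add_cancel_right_right)
  show ?thesis
    using assms(1) z by (induction xs) (simp_all add: linear_on_def)
qed

section \<open>Projection onto the tensor algebra and linear extension from words\<close>

type_synonym ('k, 'v) functional = "('v list \<Rightarrow> 'k) \<Rightarrow> 'k"

text \<open>A basis of T(V) stays independent in the whole function space, so the identity on it
  extends linearly; controlling the range of the extension keeps all values in T(V).\<close>

lemma tensor_algebra_projection:
  fixes s :: "'k::field \<Rightarrow> 'v::ab_group_add \<Rightarrow> 'v"
  shows "\<exists>P. linear_on fscale UNIV fscale P \<and> (\<forall>p\<in>TV s. P p = p) \<and> (\<forall>p. P p \<in> TV s)"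
proof -
  interpret P: vector_space_pair "fscale :: 'k \<Rightarrow> ('k, 'v) functional \<Rightarrow> _"
    "fscale :: 'k \<Rightarrow> ('k, 'v) functional \<Rightarrow> _"
    using vector_space_fscale by (simp add: vector_space_pair_def)
  obtain B where B: "B \<subseteq> TV s" "P.vs1.independent B" "TV s \<subseteq> P.vs1.span B"
    by (rule P.vs1.maximal_independent_subset)
  have "P.vs1.span B = TV s"
    using B P.vs1.span_mono[OF B(1)] P.vs1.span_span unfolding tensor_algebra_def by blast
  obtain P where P: "Vector_Spaces.linear fscale fscale P" "\<And>b. b \<in> B \<Longrightarrow> P b = id b"
    "range P = P.vs1.span (id ` B)"
    using P.linear_independent_extend_subspace[OF B(2), of id] by blast
  have "P p = id p" if "p \<in> P.vs1.span B" for p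
    by (rule linear_on_span_eqI[OF vector_space_fscale vector_space_fscale _ _ P(2) that])
      (use P(1) in \<open>auto simp: linear_on_def Vector_Spaces.linear_iff\<close>)
  with P B \<open>P.vs1.span B = TV s\<close> show ?thesis
    by (intro exI[of _ P]) (auto intro: linear_imp_linear_on)
qed

locale tensor_words = vector_space s
  for s :: "'k::field_char_0 \<Rightarrow> 'v::ab_group_add \<Rightarrow> 'v"
begin

abbreviation W :: "'v list \<Rightarrow> ('k, 'v) functional" where "W \<equiv> tens s UNIV"

abbreviation lin where "lin r t f \<equiv> linear_on r UNIV t f"

lemma vs: "vector_space s" by (rule vector_space_axioms)

lemmas vsf = vector_space_fscale

sublocale F: vector_space "fscale :: 'k \<Rightarrow> ('b \<Rightarrow> 'k) \<Rightarrow> 'b \<Rightarrow> 'k"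
  by (rule vector_space_fscale)

text \<open>
  A projection of the whole function space onto \<open>T(V)\<close>.  Composing with it turns the operations
  on \<open>T(V)\<close> into globally linear ones, so that no membership conditions arise below.
\<close>

definition tproj :: "('k, 'v) functional \<Rightarrow> ('k, 'v) functional" where
  "tproj = (SOME P. linear_on fscale UNIV fscale P \<and> (\<forall>p\<in>TV s. P p = p) \<and> (\<forall>p. P p \<in> TV s))"

lemma lin_tproj: "lin fscale fscale tproj"
  and tproj_id: "p \<in> TV s \<Longrightarrow> tproj p = p"
  and tproj_in [simp]: "tproj p \<in> TV s"
  using someI_ex[OF tensor_algebra_projection] unfolding tproj_def by blast+

lemma W_in [simp]: "W w \<in> TV s"
  unfolding tensor_algebra_def by (intro F.span_base) simp

lemma tproj_W [simp]: "tproj (W w) = W w"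
  by (simp add: tproj_id)

lemma tproj_tproj [simp]: "tproj (tproj p) = tproj p"
  by (simp add: tproj_id)

definition ext :: "('k \<Rightarrow> 'w::ab_group_add \<Rightarrow> 'w) \<Rightarrow> ('v list \<Rightarrow> 'w) \<Rightarrow> ('k, 'v) functional \<Rightarrow> 'w"
  where "ext t f p = lin_ext s t f (tproj p)"

abbreviation multilin where "multilin t f \<equiv> multilinear s UNIV t f"

lemma ext_W: "vector_space t \<Longrightarrow> multilin t f \<Longrightarrow> ext t f (W w) = f w"
  by (simp add: ext_def lin_ext_tword)

lemma ext_tproj [simp]: "ext t f (tproj p) = ext t f p"
  by (simp add: ext_def)

lemma lin_ext: "vector_space t \<Longrightarrow> multilin t f \<Longrightarrow> lin fscale t (ext t f)"
  using lin_ext_linear[of t s f] lin_tproj by (simp add: linear_on_def ext_def)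

lemma TV_eqI:
  assumes "vector_space t" "lin fscale t f" "lin fscale t g" "\<And>w. f (W w) = g (W w)" "p \<in> TV s"
  shows "f p = g p"
  by (rule linear_on_span_eqI[OF vsf assms(1) _ _ _ assms(5)[unfolded tensor_algebra_def]])
    (use assms(2-4) in \<open>auto simp: linear_on_def\<close>)

lemma words_eqI:
  assumes "vector_space t" "lin fscale t f" "lin fscale t g" "\<And>w. f (W w) = g (W w)"
    and "\<And>p. f (tproj p) = f p" "\<And>p. g (tproj p) = g p"
  shows "f p = g p"
  using TV_eqI[OF assms(1-4) tproj_in[of p]] assms(5,6) by simp

lemma multilin_lin: "multilin t f \<Longrightarrow> lin s t (\<lambda>z. f (us @ z # vs))"
  by (simp add: multilinear_def)

lemma multilin_W: "multilin fscale W"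
  by (rule multilinear_tword[OF vs])

lemma lin_add: "vector_space t \<Longrightarrow> lin r t f \<Longrightarrow> lin r t g \<Longrightarrow> lin r t (\<lambda>z. f z + g z)"
  by (simp add: linear_on_def vector_space.vector_space_assms(1))

text \<open>Additivity and homogeneity in the parameter are equations between maps linear in
  \<open>q\<close>, so words suffice. This yields linearity in the second argument of products
  defined by nested extensions.\<close>

lemma lin_ext_fun:
  assumes t: "vector_space t" and f: "\<And>p. multilin t (f p)" and lf: "\<And>w. lin r t (\<lambda>p. f p w)"
  shows "lin r t (\<lambda>p. ext t (f p) q)"
proof -
  interpret t: vector_space t by fact
  have f_add: "f (x + y) w = f x w + f y w" and f_scale: "f (r c x) w = t c (f x w)" for x y c w
    using lf[of w] by (simp_all add: linear_on_def)
  have 1: "ext t (f (x + y)) q = ext t (f x) q + ext t (f y) q" for x y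
    by (rule words_eqI[OF t, where f = "ext t (f (x + y))" and g = "\<lambda>q. ext t (f x) q + ext t (f y) q"])
      (auto intro!: lin_add t lin_ext f simp: ext_W[OF t f] f_add)
  have 2: "ext t (f (r c x)) q = t c (ext t (f x) q)" for c x
  proof (rule words_eqI[OF t, where f = "ext t (f (r c x))" and g = "\<lambda>q. t c (ext t (f x) q)"])
    show "lin fscale t (\<lambda>q. t c (ext t (f x) q))"
      using lin_ext[OF t f[of x]] by (simp add: linear_on_def t.scale_right_distrib mult.commute)
  qed (auto intro!: lin_ext t f simp: ext_W[OF t f] f_scale)
  show ?thesis using 1 2 by (simp add: linear_on_def)
qed

section \<open>Prepending a letter and the shuffle product\<close>

definition L :: "'v \<Rightarrow> ('k, 'v) functional \<Rightarrow> ('k, 'v) functional"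
  where "L x p = ext fscale (\<lambda>w. W (x # w)) p"

lemma multilin_Cons: "multilin t f \<Longrightarrow> multilin t (\<lambda>w. f (x # w))"
  unfolding multilinear_def by (auto simp del: append_Cons simp flip: append_Cons)

lemma W_Cons: "W (x # w) = L x (W w)"
  by (simp add: L_def ext_W[OF vsf] multilin_Cons multilin_W)

lemma lin_compose: "lin q t f \<Longrightarrow> lin r q h \<Longrightarrow> lin r t (\<lambda>z. f (h z))"
  by (simp add: linear_on_def)

lemma lin_id: "lin r r (\<lambda>x. x)"
  by (simp add: linear_on_def)

lemma lin_L2: "lin r fscale h \<Longrightarrow> lin r fscale (\<lambda>z. L x (h z))"
  unfolding L_def by (intro lin_compose[OF lin_ext[OF vsf]] multilin_Cons multilin_W)

lemma lin_L1: "lin r s h \<Longrightarrow> lin r fscale (\<lambda>z. L (h z) p)"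
  unfolding L_def
proof (rule lin_ext_fun[where f = "\<lambda>z w. W (h z # w)", OF vsf])
  show "lin r s h \<Longrightarrow> lin r fscale (\<lambda>z. W (h z # w))" for w
    using multilin_lin[OF multilin_W, of "[]" w] by (simp add: linear_on_def)
qed (intro multilin_Cons multilin_W)

lemma L_tproj [simp]: "L x (tproj p) = L x p"
  by (simp add: L_def)

definition sh :: "('k, 'v) functional \<Rightarrow> ('k, 'v) functional \<Rightarrow> ('k, 'v) functional"
  where "sh p q = ext fscale (\<lambda>xs. ext fscale (\<lambda>ys. \<Sum>w\<leftarrow>shuf xs ys. W w) q) p"

lemma sh_eq: "p \<in> TV s \<Longrightarrow> q \<in> TV s \<Longrightarrow> shuffle_prod s p q = sh p q"
  by (simp add: shuffle_prod_def sh_def ext_def tproj_id)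

lemma sh_tproj [simp]: "sh (tproj p) q = sh p q" "sh p (tproj q) = sh p q"
  by (simp_all add: sh_def)

lemma multilin_shuf:
  "multilin fscale (\<lambda>ys. \<Sum>w\<leftarrow>shuf xs ys. W w)"  "multilin fscale (\<lambda>xs. \<Sum>w\<leftarrow>shuf xs ys. W w)"
  unfolding multilinear_def
  by (intro ballI linear_shuf_right[OF vs vsf multilin_W] linear_shuf_left[OF vs vsf multilin_W])+

lemma multilinI: "(\<And>us vs. lin s t (\<lambda>z. f (us @ z # vs))) \<Longrightarrow> multilin t f"
  by (simp add: multilinear_def)

lemma multilin_sh: "multilin fscale (\<lambda>xs. ext fscale (\<lambda>ys. \<Sum>w\<leftarrow>shuf xs ys. W w) q)"
proof (rule multilinI)
  fix us vs
  show "lin s fscale (\<lambda>z. ext fscale (\<lambda>ys. \<Sum>w\<leftarrow>shuf (us @ z # vs) ys. W w) q)"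
    by (rule lin_ext_fun[where f = "\<lambda>z ys. \<Sum>w\<leftarrow>shuf (us @ z # vs) ys. W w"])
      (rule vsf multilin_shuf(1) multilin_lin[where f = "\<lambda>xs. \<Sum>w\<leftarrow>shuf xs ys. W w" for ys, OF multilin_shuf(2)])+
qed

lemma lin_sh1: "lin r fscale h \<Longrightarrow> lin r fscale (\<lambda>p. sh (h p) q)"
  unfolding sh_def by (rule lin_compose[OF lin_ext[OF vsf multilin_sh]])

lemma lin_sh2: "lin r fscale h \<Longrightarrow> lin r fscale (\<lambda>q. sh p (h q))"
  unfolding sh_def
  by (rule lin_compose[where q = fscale and h = h],
      rule lin_ext_fun[where f = "\<lambda>q xs. ext fscale (\<lambda>ys. \<Sum>w\<leftarrow>shuf xs ys. W w) q"])
    (rule vsf multilin_sh lin_ext multilin_shuf(1) | assumption)+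

lemma sh_W: "sh (W xs) (W ys) = (\<Sum>w\<leftarrow>shuf xs ys. W w)"
  by (simp add: sh_def ext_W[OF vsf] multilin_sh multilin_shuf)

text \<open>Linear maps on T(V), encoded as total functions that factor through the projection. For
  these, agreement on words forces equality as functions.\<close>

definition tlin :: "('k \<Rightarrow> 'w::ab_group_add \<Rightarrow> 'w) \<Rightarrow> (('k, 'v) functional \<Rightarrow> 'w) \<Rightarrow> bool"
  where "tlin t f \<longleftrightarrow> lin fscale t f \<and> (\<forall>p. f (tproj p) = f p)"

lemma tlin_lin: "tlin t f \<Longrightarrow> lin fscale t f"
  by (simp add: tlin_def)

lemma words_ext:
  assumes "vector_space t" "tlin t f" "tlin t g" "\<And>w. f (W w) = g (W w)"
  shows "f = g"
proof (rule HOL.ext)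
  show "f p = g p" for p
    by (rule words_eqI[OF assms(1), of f g]) (use assms(2-4) in \<open>simp_all add: tlin_def\<close>)
qed

text \<open>Projecting the extension changes nothing on words, hence nothing at all, so its values
  are fixed by \<open>tproj\<close>.\<close>

lemma ext_in: "multilin fscale f \<Longrightarrow> (\<And>w. f w \<in> TV s) \<Longrightarrow> ext fscale f p \<in> TV s"
proof -
  assume f: "multilin fscale f" "\<And>w. f w \<in> TV s"
  have "(\<lambda>p. tproj (ext fscale f p)) = ext fscale f"
    by (rule words_ext[OF vsf])
      (simp_all add: tlin_def lin_ext[OF vsf f(1)] lin_compose[OF lin_tproj lin_ext[OF vsf f(1)]]
        ext_W[OF vsf f(1)] tproj_id[OF f(2)])
  from fun_cong[OF this, of p] show ?thesis by (metis tproj_in)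
qed

lemma L_in [simp]: "L x p \<in> TV s"
  unfolding L_def by (rule ext_in) (simp_all add: multilin_Cons[OF multilin_W])

lemma zero_in [simp]: "0 \<in> TV s"
  unfolding tensor_algebra_def by (rule F.span_zero)

lemma add_in: "p \<in> TV s \<Longrightarrow> q \<in> TV s \<Longrightarrow> p + q \<in> TV s"
  unfolding tensor_algebra_def by (rule F.span_add)

lemma scale_in: "p \<in> TV s \<Longrightarrow> fscale c p \<in> TV s"
  unfolding tensor_algebra_def by (rule F.span_scale)

lemma sum_list_in: "(\<And>w. f w \<in> TV s) \<Longrightarrow> (\<Sum>w\<leftarrow>ws. f w) \<in> TV s"
  by (induction ws) (simp_all add: add_in)

lemma sh_in [simp]: "sh p q \<in> TV s"
  unfolding sh_def
  by (intro ext_in multilin_sh multilin_shuf(1) sum_list_in W_in)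

lemma tproj_L_sh [simp]: "tproj (L x p) = L x p" "tproj (sh p q) = sh p q"
  by (simp_all add: tproj_id)

lemma tlin_sh_L:
  "tlin fscale (\<lambda>p. sh p q)" "tlin fscale (\<lambda>p. sh q p)" "tlin fscale (L x)" "tlin fscale tproj"
  by (simp_all add: tlin_def lin_sh1[OF lin_id] lin_sh2[OF lin_id] lin_L2[OF lin_id] lin_tproj)

lemma sh_one [simp]: "sh (W []) q = tproj q" "sh q (W []) = tproj q"
proof -
  have "sh (W []) = tproj"
    by (rule words_ext[OF vsf]) (simp_all add: tlin_sh_L sh_W)
  then show "sh (W []) q = tproj q" by simp
  have "shuf xs [] = [xs]" for xs :: "'v list" by (cases xs) simp_all
  then have "(\<lambda>q. sh q (W [])) = tproj"
    by (intro words_ext[OF vsf]) (simp_all add: tlin_sh_L sh_W)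
  then show "sh q (W []) = tproj q" by (rule fun_cong)
qed

lemma L_add [simp]: "L x (p + q) = L x p + L x q"
  and L_zero [simp]: "L x 0 = 0"
  and L_add_left: "L (x + y) p = L x p + L y p"
  and L_minus_left: "L (- x) p = - L x p"
  and L_zero_left [simp]: "L 0 p = 0"
proof -
  show add: "L x (p + q) = L x p + L x q" for p q
    using lin_L2[OF lin_id, of x] by (simp add: linear_on_def)
  then show "L x 0 = 0" by (metis add_cancel_right_right)
  show add: "L (x + y) p = L x p + L y p" for x y
    using lin_L1[OF lin_id] by (simp add: linear_on_def)
  then show 0: "L 0 p = 0" by (metis add_cancel_right_right)
  show "L (- x) p = - L x p" using add[of x "- x"] 0 by (simp add: eq_neg_iff_add_eq_0 add.commute)
qed

lemma sh_add [simp]: "sh (p + q) r = sh p r + sh q r" "sh r (p + q) = sh r p + sh r q"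
  and sh_zero [simp]: "sh 0 r = 0" "sh r 0 = 0"
proof -
  show 1: "sh (p + q) r = sh p r + sh q r" for p q
    using lin_sh1[OF lin_id, of r] by (simp add: linear_on_def)
  show 2: "sh r (p + q) = sh r p + sh r q" for p q
    using lin_sh2[OF lin_id, of r] by (simp add: linear_on_def)
  show "sh 0 r = 0" "sh r 0 = 0"
    using 1[of 0 0] 2[of 0 0] by simp_all
qed

lemmas lin_intros = lin_id lin_L1 lin_L2 lin_sh1 lin_sh2 lin_add[OF vsf]

lemma L_sum_list: "L x (\<Sum>w\<leftarrow>ws. f w) = (\<Sum>w\<leftarrow>ws. L x (f w))"
  by (induction ws) (simp_all only: list.map sum_list.Nil sum_list.Cons L_add L_zero)

text \<open>The recursion of \<open>shuf\<close> survives linear extension. It spreads from words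
  one argument at a time, a pattern that recurs for the multilinear identities below.\<close>

lemma sh_L_L: "sh (L x p) (L y q) = L x (sh p (L y q)) + L y (sh (L x p) q)"
proof -
  have 1: "sh (L x (W u)) (L y (W v)) = L x (sh (W u) (L y (W v))) + L y (sh (L x (W u)) (W v))" for u v
  proof -
    have "sh (W (x # u)) (W (y # v)) = L x (sh (W u) (W (y # v))) + L y (sh (W (x # u)) (W v))"
      unfolding sh_W by (simp add: comp_def W_Cons[of x] W_Cons[of y] L_sum_list)
    then show ?thesis unfolding W_Cons .
  qed
  have 2: "(\<lambda>p. sh (L x p) (L y (W v))) = (\<lambda>p. L x (sh p (L y (W v))) + L y (sh (L x p) (W v)))" for v
    by (rule words_ext[OF vsf]) (auto simp: tlin_def 1 intro!: lin_intros)
  have 3: "(\<lambda>q. sh (L x p) (L y q)) = (\<lambda>q. L x (sh p (L y q)) + L y (sh (L x p) q))"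
    by (rule words_ext[OF vsf]) (auto simp: tlin_def fun_cong[OF 2] intro!: lin_intros)
  show ?thesis by (rule fun_cong[OF 3])
qed

lemma sh_commute: "sh p q = sh q p"
proof -
  have 1: "sh (W u) (W v) = sh (W v) (W u)" for u v
    unfolding sh_W by (rule sum_shuf_commute[OF vs vsf])
  have 2: "(\<lambda>p. sh p (W v)) = (\<lambda>p. sh (W v) p)" for v
    by (rule words_ext[OF vsf]) (auto simp: tlin_def 1 intro!: lin_intros)
  have 3: "(\<lambda>q. sh p q) = (\<lambda>q. sh q p)"
    by (rule words_ext[OF vsf]) (auto simp: tlin_def fun_cong[OF 2] intro!: lin_intros)
  show ?thesis by (rule fun_cong[OF 3])
qed

text \<open>Expanding by \<open>sh_L_L\<close> sorts both sides by the first letter of the result,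
  \<open>x\<close>, \<open>y\<close> or \<open>z\<close>; each group is the claim with one letter
  removed.\<close>

lemma sh_assoc_W: "sh (sh (W a) (W b)) (W c) = sh (W a) (sh (W b) (W c))"
proof (induction "length a + length b + length c" arbitrary: a b c rule: less_induct)
  case less
  show ?case
  proof (cases "a = [] \<or> b = [] \<or> c = []")
    case False
    then obtain x u y v z w where [simp]: "a = x # u" "b = y # v" "c = z # w"
      by (metis list.exhaust)
    have "L x (sh (sh (W u) (W b)) (W c)) = L x (sh (W u) (sh (W b) (W c)))"
      "L y (sh (sh (W a) (W v)) (W c)) = L y (sh (W a) (sh (W v) (W c)))"
      "L z (sh (sh (W a) (W b)) (W w)) = L z (sh (W a) (sh (W b) (W w)))"
      by (rule arg_cong[where f = "L _"], rule less; simp)+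
    then show ?thesis by (simp add: W_Cons sh_L_L algebra_simps)
  qed auto
qed

lemma sh_assoc: "sh (sh p q) r = sh p (sh q r)"
proof -
  have 2: "(\<lambda>p. sh (sh p (W v)) (W w)) = (\<lambda>p. sh p (sh (W v) (W w)))" for v w
    by (rule words_ext[OF vsf]) (auto simp: tlin_def sh_assoc_W intro!: lin_intros)
  have 3: "(\<lambda>q. sh (sh p q) (W w)) = (\<lambda>q. sh p (sh q (W w)))" for w
    by (rule words_ext[OF vsf]) (auto simp: tlin_def fun_cong[OF 2] intro!: lin_intros)
  have 4: "(\<lambda>r. sh (sh p q) r) = (\<lambda>r. sh p (sh q r))"
    by (rule words_ext[OF vsf]) (auto simp: tlin_def fun_cong[OF 3] intro!: lin_intros)
  show ?thesis by (rule fun_cong[OF 4])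
qed

lemma sh_left_commute: "sh p (sh q r) = sh q (sh p r)"
  by (metis sh_assoc sh_commute)

lemmas sh_ac = sh_assoc sh_commute sh_left_commute

section \<open>Bilinear test maps and the deconcatenation coproduct\<close>

lemma lin_cut:
  "vector_space t \<Longrightarrow> (\<And>u v. lin r t (\<lambda>x. g x u v)) \<Longrightarrow> lin r t (\<lambda>x. cut (g x) w)"
  by (induction w arbitrary: g) (simp_all add: lin_add)

definition bilin where "bilin t g \<longleftrightarrow> (\<forall>q. tlin t (\<lambda>p. g p q)) \<and> (\<forall>p. tlin t (g p))"

lemma bilinI:
  assumes "\<And>q. lin fscale t (\<lambda>p. g p q)" "\<And>p. lin fscale t (\<lambda>q. g p q)"
    and "\<And>p q. g (tproj p) q = g p q" "\<And>p q. g p (tproj q) = g p q"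
  shows "bilin t g"
  using assms by (simp add: bilin_def tlin_def)

lemma bilin_lin1: "bilin t g \<Longrightarrow> lin r fscale h \<Longrightarrow> lin r t (\<lambda>z. g (h z) q)"
  using lin_compose[of fscale t "\<lambda>p. g p q" r h] by (simp add: bilin_def tlin_def)

lemma bilin_lin2: "bilin t g \<Longrightarrow> lin r fscale h \<Longrightarrow> lin r t (\<lambda>z. g p (h z))"
  using lin_compose[of fscale t "g p" r h] by (simp add: bilin_def tlin_def)

lemma bilin_tproj: "bilin t g \<Longrightarrow> g (tproj p) q = g p q" "bilin t g \<Longrightarrow> g p (tproj q) = g p q"
  by (simp_all add: bilin_def tlin_def)

lemma bilin_add:
  "bilin t g \<Longrightarrow> g (p + q) r = g p r + g q r" "bilin t g \<Longrightarrow> g r (p + q) = g r p + g r q"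
  by (simp_all add: bilin_def tlin_def linear_on_def)

lemma bilin_zero:
  assumes "bilin t g"
  shows "g 0 r = 0" "g r 0 = 0"
  using bilin_add[OF assms, of 0 0 r] bilin_add(2)[OF assms, of r 0 0] by simp_all

text \<open>This closure property is what allows an induction on words to change the test
  map.\<close>

lemma bilin_L:
  assumes g: "bilin t g"
  shows "bilin t (\<lambda>p q. g (L x p) q)"
  by (rule bilinI) (auto intro!: bilin_lin1[OF g] bilin_lin2[OF g] lin_intros simp: bilin_tproj[OF g])

lemma multilin_cut:
  assumes t: "vector_space t" and g: "bilin t g"
  shows "multilin t (\<lambda>w. cut (\<lambda>u v. g (W u) (W v)) w)"
proof (rule multilinI)
  fix us vs
  show "lin s t (\<lambda>z. cut (\<lambda>u v. g (W u) (W v)) (us @ z # vs))"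
    using g
  proof (induction us arbitrary: g)
    case Nil
    show ?case
      unfolding append_Nil cut.simps W_Cons
      by (intro lin_add[OF t] lin_cut[OF t] bilin_lin1[OF Nil] bilin_lin2[OF Nil] lin_intros)
  next
    case (Cons y us)
    show ?case
      unfolding append_Cons cut.simps
      unfolding W_Cons[of y]
      by (intro lin_add[OF t] bilin_lin2[OF Cons.prems] lin_intros multilin_lin[OF multilin_W]
        Cons.IH[OF bilin_L[OF Cons.prems]])
  qed
qed

text \<open>
  \<open>D t g p\<close> is \<open>g\<close> applied to the coproduct of \<open>p\<close>.
\<close>

definition D :: "('k \<Rightarrow> 'w::ab_group_add \<Rightarrow> 'w)
    \<Rightarrow> (('k, 'v) functional \<Rightarrow> ('k, 'v) functional \<Rightarrow> 'w) \<Rightarrow> ('k, 'v) functional \<Rightarrow> 'w"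
  where "D t g p = ext t (\<lambda>w. cut (\<lambda>u v. g (W u) (W v)) w) p"

lemma D_W: "vector_space t \<Longrightarrow> bilin t g \<Longrightarrow> D t g (W w) = cut (\<lambda>u v. g (W u) (W v)) w"
  by (simp add: D_def ext_W multilin_cut)

lemma D_tproj [simp]: "D t g (tproj p) = D t g p"
  by (simp add: D_def)

lemma lin_D: "vector_space t \<Longrightarrow> bilin t g \<Longrightarrow> lin r fscale h \<Longrightarrow> lin r t (\<lambda>z. D t g (h z))"
  unfolding D_def by (rule lin_compose[OF lin_ext[OF _ multilin_cut]])

lemma lin_D_fun:
  assumes "vector_space t" "\<And>z. bilin t (g z)" "\<And>p q. lin r t (\<lambda>z. g z p q)"
  shows "lin r t (\<lambda>z. D t (g z) p)"
  unfolding D_def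
  by (rule lin_ext_fun[where f = "\<lambda>z w. cut (\<lambda>u v. g z (W u) (W v)) w"])
    (auto intro!: assms multilin_cut lin_cut)

lemma D_add: "vector_space t \<Longrightarrow> bilin t g \<Longrightarrow> D t g (p + q) = D t g p + D t g q"
  using lin_D[of t g fscale "\<lambda>x. x"] lin_id[of fscale] by (simp add: linear_on_def)

lemma D_zero: "vector_space t \<Longrightarrow> bilin t g \<Longrightarrow> D t g 0 = 0"
  using D_add[of t g 0 0] by simp

lemma tlin_D: "vector_space t \<Longrightarrow> bilin t g \<Longrightarrow> tlin t (D t g)"
  using lin_D[of t g fscale "\<lambda>x. x"] lin_id[of fscale] by (simp add: tlin_def)

text \<open>Prepending a letter is a 1-cocycle for deconcatenation: the left part is either empty or
  starts with \<open>x\<close>. In the second case \<open>x\<close> moves into the test map.\<close>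

lemma D_L:
  assumes t: "vector_space t" and g: "bilin t g"
  shows "D t g (L x p) = g (W []) (L x p) + D t (\<lambda>p q. g (L x p) q) p"
proof -
  have "(\<lambda>p. D t g (L x p)) = (\<lambda>p. g (W []) (L x p) + D t (\<lambda>p q. g (L x p) q) p)"
  proof (rule words_ext[OF t])
    show "tlin t (\<lambda>p. D t g (L x p))"
      by (auto simp: tlin_def intro!: lin_D t g lin_intros)
    show "tlin t (\<lambda>p. g (W []) (L x p) + D t (\<lambda>p q. g (L x p) q) p)"
      by (auto simp: tlin_def intro!: lin_add[OF t] lin_D t g bilin_lin2[OF g] bilin_L lin_intros)
    show "D t g (L x (W w)) = g (W []) (L x (W w)) + D t (\<lambda>p q. g (L x p) q) (W w)" for w
      using D_W[OF t g, of "x # w"] D_W[OF t bilin_L[OF g], of x w] by (simp add: W_Cons)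
  qed
  then show ?thesis by (rule fun_cong)
qed

text \<open>The two summands of \<open>sh_L_L\<close> fall under the induction hypothesis for the
  test maps that prepend \<open>x\<close> and \<open>y\<close>; their boundary terms with
  \<open>W []\<close> add up to the contribution of the empty left parts.\<close>

lemma D_sh_W:
  assumes t: "vector_space t"
  shows "bilin t g \<Longrightarrow> D t g (sh (W a) (W b)) =
    cut (\<lambda>a1 a2. cut (\<lambda>b1 b2. g (sh (W a1) (W b1)) (sh (W a2) (W b2))) b) a"
proof (induction "length a + length b" arbitrary: a b g rule: less_induct)
  case less
  note g = less.prems
  consider "a = []" | "b = []" | x u y v where "a = x # u" "b = y # v"
    by (metis list.exhaust)
  then show ?case
  proof cases
    case 3
    note [simp] = 3
    have "D t (\<lambda>p q. g (L x p) q) (sh (W u) (W b)) =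
      cut (\<lambda>a1 a2. cut (\<lambda>b1 b2. g (L x (sh (W a1) (W b1))) (sh (W a2) (W b2))) b) u"
      "D t (\<lambda>p q. g (L y p) q) (sh (W a) (W v)) =
      cut (\<lambda>a1 a2. cut (\<lambda>b1 b2. g (L y (sh (W a1) (W b1))) (sh (W a2) (W b2))) v) a"
      by (rule less.hyps; simp add: bilin_L[OF g])+
    then show ?thesis
      by (simp add: W_Cons sh_L_L D_add[OF t g] D_L[OF t g] bilin_add[OF g] cut_add add_ac)
  qed (simp_all add: D_W[OF t g])
qed

section \<open>Changing the first letter and shuffling the rest\<close>

text \<open>
  \<open>G f p q\<close> applies \<open>f\<close> to the first letter of \<open>p\<close> and shuffles the rest of \<open>p\<close> with \<open>q\<close>.
\<close>

definition G :: "('v \<Rightarrow> 'v) \<Rightarrow> ('k, 'v) functional \<Rightarrow> ('k, 'v) functional \<Rightarrow> ('k, 'v) functional"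
  where "G f p q = ext fscale (\<lambda>w. case w of [] \<Rightarrow> 0 | z # u \<Rightarrow> L (f z) (sh (W u) q)) p"

lemma lin_zero: "vector_space t \<Longrightarrow> lin r t (\<lambda>z. 0)"
  by (simp add: linear_on_def module.scale_zero_right module_iff_vector_space[symmetric])

lemma lin_list_case:
  assumes "vector_space t" "\<And>y u. lin r t (\<lambda>z. f z y u)"
  shows "lin r t (\<lambda>z. case w of [] \<Rightarrow> 0 | y # u \<Rightarrow> f z y u)"
  using assms by (cases w) (simp_all add: lin_zero)

lemma multilin_G:
  assumes f: "lin s s f"
  shows "multilin fscale (\<lambda>w. case w of [] \<Rightarrow> 0 | z # u \<Rightarrow> L (f z) (sh (W u) q))"
proof (rule multilinI)
  fix us vs
  show "lin s fscale (\<lambda>z. case us @ z # vs of [] \<Rightarrow> 0 | z # u \<Rightarrow> L (f z) (sh (W u) q))"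
    by (cases us) (auto intro!: lin_intros f multilin_lin[OF multilin_W])
qed

lemma G_tproj [simp]: "G f (tproj p) q = G f p q" "G f p (tproj q) = G f p q"
  by (simp_all add: G_def cong: list.case_cong)

lemma lin_G1: "lin s s f \<Longrightarrow> lin r fscale h \<Longrightarrow> lin r fscale (\<lambda>z. G f (h z) q)"
  unfolding G_def by (rule lin_compose[OF lin_ext[OF vsf multilin_G]])

lemma lin_G2: "lin s s f \<Longrightarrow> lin r fscale h \<Longrightarrow> lin r fscale (\<lambda>z. G f p (h z))"
  unfolding G_def
  by (rule lin_ext_fun[where f = "\<lambda>y w. case w of [] \<Rightarrow> 0 | z # u \<Rightarrow> L (f z) (sh (W u) (h y))"])
    (auto intro!: vsf multilin_G lin_list_case lin_intros)

lemma lin_G0: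
  "(\<And>x. lin s s (f x)) \<Longrightarrow> (\<And>y. lin r s (\<lambda>x. f x y)) \<Longrightarrow> lin r fscale (\<lambda>x. G (f x) p q)"
  unfolding G_def
  by (rule lin_ext_fun[where f = "\<lambda>x w. case w of [] \<Rightarrow> 0 | z # u \<Rightarrow> L (f x z) (sh (W u) q)"])
    (auto intro!: vsf multilin_G lin_list_case lin_intros)

lemma G_one: "lin s s f \<Longrightarrow> G f (W []) q = 0"
  by (simp add: G_def ext_W[OF vsf multilin_G])

lemma G_L:
  assumes f: "lin s s f"
  shows "G f (L x p) q = L (f x) (sh p q)"
proof -
  have "(\<lambda>p. G f (L x p) q) = (\<lambda>p. L (f x) (sh p q))"
  proof (rule words_ext[OF vsf])
    show "G f (L x (W w)) q = L (f x) (sh (W w) q)" for w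
      unfolding W_Cons[symmetric] by (simp add: G_def ext_W[OF vsf multilin_G[OF f]])
  qed (auto simp: tlin_def intro!: lin_intros lin_G1 f)
  then show ?thesis by (rule fun_cong)
qed

lemma G_add:
  assumes f: "lin s s f"
  shows "G f (p + q) r = G f p r + G f q r" "G f r (p + q) = G f r p + G f r q"
    "G f 0 r = 0" "G f r 0 = 0"
proof -
  show 1: "G f (p + q) r = G f p r + G f q r" for p q
    using lin_G1[OF f lin_id, of r] by (simp add: linear_on_def)
  show 2: "G f r (p + q) = G f r p + G f r q" for p q
    using lin_G2[OF f lin_id, of r] by (simp add: linear_on_def)
  show "G f 0 r = 0" "G f r 0 = 0" using 1[of 0 0] 2[of 0 0] by simp_all
qed

text \<open>The first letter of a shuffle comes from one of the factors, and the other factor joins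
  the shuffle of the rest.\<close>

lemma G_sh:
  assumes f: "lin s s f"
  shows "G f (sh p q) r = G f p (sh q r) + G f q (sh p r)"
proof -
  have 1: "G f (sh (W a) (W b)) r = G f (W a) (sh (W b) r) + G f (W b) (sh (W a) r)" for a b
    by (cases a; cases b) (simp_all add: W_Cons G_one[OF f] G_L[OF f] sh_L_L G_add[OF f] sh_ac)
  have 2: "(\<lambda>p. G f (sh p (W b)) r) = (\<lambda>p. G f p (sh (W b) r) + G f (W b) (sh p r))" for b
    by (rule words_ext[OF vsf]) (auto simp: tlin_def 1 intro!: lin_intros lin_G1 lin_G2 f)
  have 3: "(\<lambda>q. G f (sh p q) r) = (\<lambda>q. G f p (sh q r) + G f q (sh p r))"
    by (rule words_ext[OF vsf]) (auto simp: tlin_def fun_cong[OF 2] intro!: lin_intros lin_G1 lin_G2 f)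
  show ?thesis by (rule fun_cong[OF 3])
qed

text \<open>The recursion \<open>sh_L_L\<close> applies to the result of \<open>G\<close> as well:
  it starts with a letter, or it is 0 because \<open>a\<close> is empty.\<close>

lemma sh_G_L:
  assumes f: "lin s s f"
  shows "sh (G f (W a) q) (L y p) = G f (W a) (sh q (L y p)) + L y (sh (G f (W a) q) p)"
  by (cases a) (simp_all add: W_Cons G_one[OF f] G_L[OF f] sh_L_L sh_assoc)

lemma G_G:
  assumes "lin s s f" "lin s s g"
  shows "G f (G g p q) r = G (\<lambda>x. f (g x)) p (sh q r)"
proof -
  note fg = assms lin_compose[OF assms]
  have 1: "G f (G g (W a) q) r = G (\<lambda>x. f (g x)) (W a) (sh q r)" for a
    by (cases a) (simp_all add: W_Cons G_one fg G_L G_add sh_assoc)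
  have 2: "(\<lambda>p. G f (G g p q) r) = (\<lambda>p. G (\<lambda>x. f (g x)) p (sh q r))"
    by (rule words_ext[OF vsf]) (auto simp: tlin_def 1 intro!: lin_intros lin_G1 lin_G2 fg)
  show ?thesis by (rule fun_cong[OF 2])
qed

text \<open>A left part is empty or starts with the changed letter. An empty \<open>a1\<close>
  contributes 0 because \<open>G\<close> kills the empty word, so the double sum counts exactly the
  nonempty left parts.\<close>

lemma D_G_W:
  assumes t: "vector_space t" and g: "bilin t g" and f: "lin s s f"
  shows "D t g (G f (W a) (W b)) = g (W []) (G f (W a) (W b)) +
    cut (\<lambda>a1 a2. cut (\<lambda>b1 b2. g (G f (W a1) (W b1)) (sh (W a2) (W b2))) b) a"
proof (cases a)
  case Nil
  then show ?thesis by (simp add: G_one[OF f] D_zero[OF t g] bilin_zero[OF g] cut_zero)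
next
  case (Cons x u)
  then show ?thesis
    by (simp add: W_Cons G_L[OF f] G_one[OF f] D_L[OF t g] D_sh_W[OF t bilin_L[OF g]]
      bilin_zero[OF g] cut_zero)
qed

section \<open>Tensor square, Sweedler sums and multiplicativity of the coproduct\<close>

lemma subspace_TV: "module.subspace fscale (TV s)"
  unfolding tensor_algebra_def by (rule F.subspace_span)

lemma bilin_sh: "bilin fscale sh"
  by (rule bilinI) (auto intro!: lin_sh1 lin_sh2 lin_id)

text \<open>Projecting the entries turns the pure tensor into a test map without membership
  conditions.\<close>

definition tens2 where "tens2 x y = tens fscale (TV s) [tproj x, tproj y]"
definition tens3 where "tens3 x y z = tens fscale (TV s) [tproj x, tproj y, tproj z]"

lemma lin_tens_TV:
  assumes "set us \<subseteq> TV s" "set vs \<subseteq> TV s"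
  shows "lin fscale fscale (\<lambda>x. tens fscale (TV s) (us @ tproj x # vs))"
proof -
  have "linear_on fscale (TV s) fscale (\<lambda>x. tens fscale (TV s) (us @ x # vs))"
    using multilinear_tens[OF vsf subspace_TV] assms unfolding multilinear_def by (auto simp: in_lists_conv_set)
  then show ?thesis
    using lin_tproj by (simp add: linear_on_def)
qed

lemma bilin_tens2: "bilin fscale tens2"
  using lin_tens_TV[of "[]" "[tproj _]"] lin_tens_TV[of "[tproj _]" "[]"]
  by (intro bilinI) (simp_all add: tens2_def)

lemma bilin_tens3:
  "bilin fscale (\<lambda>x y. tens3 x y z)" "bilin fscale (\<lambda>y z. tens3 x y z)"
  "lin fscale fscale (\<lambda>x. tens3 x y z)" "lin fscale fscale (\<lambda>z. tens3 x y z)"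
  "tens3 (tproj x) y z = tens3 x y z" "tens3 x y (tproj z) = tens3 x y z"
  using lin_tens_TV[of "[]" "[tproj _, tproj _]"] lin_tens_TV[of "[tproj _]" "[tproj _]"]
    lin_tens_TV[of "[tproj _, tproj _]" "[]"]
  by (auto intro!: bilinI simp: tens3_def)

lemma deconc_eq: "a \<in> TV s \<Longrightarrow> deconc s a = D fscale tens2 a"
  by (simp add: deconc_def D_def ext_def cut_eq_sum tens2_def tproj_id[of a])

lemma cut_linear:
  assumes "lin fscale t F"
  shows "F (cut g w) = cut (\<lambda>u v. F (g u v)) w"
  using assms by (induction w arbitrary: g) (simp_all add: linear_on_def)

text \<open>This is the universal property of the tensor square, obtained by applying
  \<open>tensor_algebra_lift\<close> to the space T(V) itself. It turns equations between tensors
  into equations between values of \<open>D\<close>.\<close>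

lemma tensor_square_lift:
  assumes t: "vector_space t" and g: "bilin t g"
  obtains F where "lin fscale t F" "\<And>x y. F (tens2 x y) = g x y" "\<And>p. F (D fscale tens2 p) = D t g p"
proof -
  \<comment> \<open>Lists of length other than two are sent to 0, which keeps \<open>f\<close>
    multilinear on lists of every length.\<close>
  define f where "f ps = (case ps of [x, y] \<Rightarrow> g x y | _ \<Rightarrow> 0)" for ps
  have "multilinear fscale (TV s) t f"
    unfolding multilinear_def
  proof (intro ballI)
    fix us vs
    have f_zero: "f ps = 0" if "length ps \<noteq> 2" for ps
      using that by (auto simp: f_def split: list.split)
    have "lin fscale t (\<lambda>x. f (us @ x # vs))"
    proof (cases "length us + length vs = 1")
      case True
      then have "(us = [] \<and> (\<exists>q. vs = [q])) \<or> ((\<exists>p. us = [p]) \<and> vs = [])"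
        by (cases us; cases vs) auto
      then show ?thesis
        by (auto simp: f_def bilin_lin1[OF g lin_id] bilin_lin2[OF g lin_id])
    qed (simp add: f_zero lin_zero[OF t])
    then show "linear_on fscale (TV s) t (\<lambda>x. f (us @ x # vs))"
      by (simp add: linear_on_def)
  qed
  from tensor_algebra_lift[OF t this] obtain F where
    F: "lin fscale t F" "\<And>xs. xs \<in> lists (TV s) \<Longrightarrow> F (tens fscale (TV s) xs) = f xs"
    using linear_imp_linear_on by blast
  have tens2: "F (tens2 x y) = g x y" for x y
    using F(2)[of "[tproj x, tproj y]"] by (simp add: tens2_def f_def bilin_tproj[OF g])
  have "(\<lambda>p. F (D fscale tens2 p)) = D t g"
  proof (rule words_ext[OF t])
    show "tlin t (\<lambda>p. F (D fscale tens2 p))"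
      by (auto simp: tlin_def intro!: lin_compose[OF F(1)] lin_D vsf bilin_tens2 lin_id)
    show "tlin t (D t g)"
      by (rule tlin_D[OF t g])
    show "F (D fscale tens2 (W w)) = D t g (W w)" for w
      by (simp add: D_W[OF t g] D_W[OF vsf bilin_tens2] cut_linear[OF F(1)] tens2)
  qed
  from that[OF F(1) tens2 fun_cong[OF this]] show thesis .
qed

text \<open>The entries of \<open>R a\<close> lie in T(V), where the given operations agree with
  their total versions; this lemma exchanges them under the sum.\<close>

lemma sum_list_sweedler_cong:
  assumes R: "sweedler fscale (TV s) (deconc s) R" and a: "a \<in> TV s"
    and "\<And>x y. x \<in> TV s \<Longrightarrow> y \<in> TV s \<Longrightarrow> f x y = g x y"
  shows "(\<Sum>(x, y)\<leftarrow>R a. f x y) = (\<Sum>(x, y)\<leftarrow>R a. g x y)"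
proof -
  have "x \<in> TV s \<and> y \<in> TV s" if "(x, y) \<in> set (R a)" for x y
    using R a that unfolding sweedler_def by blast
  then show ?thesis
    by (intro arg_cong[where f = sum_list] map_cong refl) (use assms(3) in auto)
qed

text \<open>All representatives define the same tensor, and a bilinear map sees only this tensor;
  hence the sum does not depend on \<open>R\<close>.\<close>

lemma sweedler_sum:
  assumes R: "sweedler fscale (TV s) (deconc s) R" and t: "vector_space t" and g: "bilin t g"
    and a: "a \<in> TV s"
  shows "(\<Sum>(x, y)\<leftarrow>R a. g x y) = D t g a"
proof -
  obtain F where F: "lin fscale t F" "\<And>x y. F (tens2 x y) = g x y" "\<And>p. F (D fscale tens2 p) = D t g p"
    using tensor_square_lift[OF t g] by blast
  have "D fscale tens2 a = (\<Sum>(x, y)\<leftarrow>R a. tens fscale (TV s) [x, y])"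
    using R a unfolding sweedler_def by (simp add: deconc_eq[symmetric])
  also have "\<dots> = (\<Sum>(x, y)\<leftarrow>R a. tens2 x y)"
    by (rule sum_list_sweedler_cong[OF R a]) (simp add: tens2_def tproj_id)
  finally have "D t g a = F (\<Sum>(x, y)\<leftarrow>R a. tens2 x y)"
    by (simp add: F(3)[symmetric])
  also have "\<dots> = (\<Sum>(x, y)\<leftarrow>R a. g x y)"
    by (simp add: linear_on_apply_sum_list[OF F(1) t] case_prod_unfold F(2))
  finally show ?thesis ..
qed

text \<open>Serves both compatibility conditions: \<open>h\<close> is \<open>sh\<close> or the
  pre-Lie product, \<open>k\<close> is \<open>sh\<close>, and the nested \<open>D\<close> runs
  through the coproducts of both arguments.\<close>

lemma bilin_two_fold:
  assumes t: "vector_space t" and g: "bilin t g" and h: "bilin fscale h" "bilin fscale k"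
  shows "bilin t (\<lambda>q1 q2. g (h p1 q1) (k p2 q2))"
    and "bilin t (\<lambda>p1 p2. D t (\<lambda>q1 q2. g (h p1 q1) (k p2 q2)) q)"
    and "lin fscale t (\<lambda>q. D t (\<lambda>p1 p2. D t (\<lambda>q1 q2. g (h p1 q1) (k p2 q2)) q) p)"
proof -
  note lin = bilin_lin1[OF g] bilin_lin2[OF g] bilin_lin1[OF h(1)] bilin_lin2[OF h(1)]
    bilin_lin1[OF h(2)] bilin_lin2[OF h(2)] lin_id
  note tp = bilin_tproj[OF g] bilin_tproj[OF h(1)] bilin_tproj[OF h(2)]
  show 1: "bilin t (\<lambda>q1 q2. g (h p1 q1) (k p2 q2))" for p1 p2
    by (rule bilinI; (intro lin)?; simp add: tp)
  show 2: "bilin t (\<lambda>p1 p2. D t (\<lambda>q1 q2. g (h p1 q1) (k p2 q2)) q)" for q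
  proof (rule bilinI)
    show "lin fscale t (\<lambda>p1. D t (\<lambda>q1 q2. g (h p1 q1) (k p2 q2)) q)" for p2
      by (rule lin_D_fun[where g = "\<lambda>p1 q1 q2. g (h p1 q1) (k p2 q2)", OF t 1]) (intro lin)
    show "lin fscale t (\<lambda>p2. D t (\<lambda>q1 q2. g (h p1 q1) (k p2 q2)) q)" for p1
      by (rule lin_D_fun[where g = "\<lambda>p2 q1 q2. g (h p1 q1) (k p2 q2)", OF t 1]) (intro lin)
  qed (simp_all add: tp)
  show "lin fscale t (\<lambda>q. D t (\<lambda>p1 p2. D t (\<lambda>q1 q2. g (h p1 q1) (k p2 q2)) q) p)"
    by (rule lin_D_fun[where g = "\<lambda>q p1 p2. D t (\<lambda>q1 q2. g (h p1 q1) (k p2 q2)) q", OF t 2])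
      (intro lin_D t 1 lin_id)
qed

lemma D_two_fold_W:
  assumes t: "vector_space t" and g: "bilin t g" and h: "bilin fscale h" "bilin fscale k"
  shows "D t (\<lambda>p1 p2. D t (\<lambda>q1 q2. g (h p1 q1) (k p2 q2)) (W b)) (W a) =
    cut (\<lambda>a1 a2. cut (\<lambda>b1 b2. g (h (W a1) (W b1)) (k (W a2) (W b2))) b) a"
  by (subst D_W[OF t bilin_two_fold(2)[OF assms]]) (simp only: D_W[OF t bilin_two_fold(1)[OF assms]])

lemma D_sh:
  assumes t: "vector_space t" and g: "bilin t g"
  shows "D t g (sh p q) = D t (\<lambda>p1 p2. D t (\<lambda>q1 q2. g (sh p1 q1) (sh p2 q2)) q) p"
proof -
  note two = bilin_two_fold[OF t g bilin_sh bilin_sh]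
  have 1: "(\<lambda>p. D t g (sh p (W b))) = (\<lambda>p. D t (\<lambda>p1 p2. D t (\<lambda>q1 q2. g (sh p1 q1) (sh p2 q2)) (W b)) p)" for b
  proof (rule words_ext[OF t])
    show "tlin t (\<lambda>p. D t g (sh p (W b)))"
      by (simp add: tlin_def lin_D[OF t g lin_sh1[OF lin_id]])
    show "tlin t (\<lambda>p. D t (\<lambda>p1 p2. D t (\<lambda>q1 q2. g (sh p1 q1) (sh p2 q2)) (W b)) p)"
      by (rule tlin_D[OF t two(2)])
  qed (simp add: D_two_fold_W[OF t g bilin_sh bilin_sh] D_sh_W[OF t g])
  have 2: "(\<lambda>q. D t g (sh p q)) = (\<lambda>q. D t (\<lambda>p1 p2. D t (\<lambda>q1 q2. g (sh p1 q1) (sh p2 q2)) q) p)"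
    by (rule words_ext[OF t])
      (simp_all add: fun_cong[OF 1] tlin_def lin_D[OF t g lin_sh2[OF lin_id]] two(3))
  show ?thesis by (rule fun_cong[OF 2])
qed

section \<open>The counit and the shuffle bialgebra\<close>

definition eps :: "('k, 'v) functional \<Rightarrow> 'k"
  where "eps = ext (*) (\<lambda>w. if w = [] then 1 else 0)"

lemma multilin_eps: "multilin (*) (\<lambda>w. if w = [] then 1 else (0::'k))"
  by (rule multilinI) (simp add: linear_on_def)

lemma lin_eps: "lin fscale (*) eps"
  unfolding eps_def by (rule lin_ext[OF vector_space_mult multilin_eps])

lemma eps_W: "eps (W w) = (if w = [] then 1 else 0)"
  unfolding eps_def by (rule ext_W[OF vector_space_mult multilin_eps])

lemma eps_tproj [simp]: "eps (tproj p) = eps p"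
  by (simp add: eps_def)

lemma eps_add: "eps (p + q) = eps p + eps q"
  using lin_eps by (simp add: linear_on_def)

lemma eps_scale: "eps (fscale c p) = c * eps p"
  using lin_eps by (simp add: linear_on_def)

lemma eps_L: "eps (L x p) = 0"
proof -
  have "(\<lambda>p. eps (L x p)) = (\<lambda>p. 0)"
    by (rule words_ext[OF vector_space_mult])
      (auto simp: tlin_def W_Cons[symmetric] eps_W intro!: lin_compose[OF lin_eps] lin_intros lin_zero vector_space_mult)
  from fun_cong[OF this, of p] show ?thesis .
qed

lemma eps_sh: "eps (sh p q) = eps p * eps q"
proof -
  have w: "eps (sh (W a) (W b)) = eps (W a) * eps (W b)" for a b
    by (cases a; cases b) (simp_all add: W_Cons sh_L_L eps_add eps_L eps_W)
  have mult: "lin fscale (*) (\<lambda>p. eps p * c)" "lin fscale (*) (\<lambda>p. c * eps p)" for c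
    by (simp_all add: linear_on_def eps_add eps_scale algebra_simps)
  have 1: "(\<lambda>p. eps (sh p (W b))) = (\<lambda>p. eps p * eps (W b))" for b
    by (rule words_ext[OF vector_space_mult])
      (auto simp: tlin_def w mult intro!: lin_compose[OF lin_eps] lin_intros)
  have 2: "(\<lambda>q. eps (sh p q)) = (\<lambda>q. eps p * eps q)"
    by (rule words_ext[OF vector_space_mult])
      (auto simp: tlin_def fun_cong[OF 1] mult intro!: lin_compose[OF lin_eps] lin_intros)
  show ?thesis by (rule fun_cong[OF 2])
qed

lemma lin_fscale: "lin r (*) (f :: _ \<Rightarrow> 'k) \<Longrightarrow> lin r fscale (\<lambda>x. fscale (f x) q)"
  "lin r fscale h \<Longrightarrow> lin r fscale (\<lambda>x. fscale (c::'k) (h x))"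
  by (simp_all add: linear_on_def fscale_def fun_eq_iff plus_fun_apply algebra_simps)

lemma is_counit_eps: "is_counit fscale (TV s) (deconc s) eps"
  unfolding is_counit_def
proof (intro conjI allI impI ballI)
  show "linear_on fscale (TV s) (*) eps" using lin_eps by (simp add: linear_on_def)
  fix R a assume R: "sweedler fscale (TV s) (deconc s) R" and a: "a \<in> TV s"
  have b: "bilin fscale (\<lambda>x y. fscale (eps x) (tproj y))" "bilin fscale (\<lambda>x y. fscale (eps y) (tproj x))"
    by (rule bilinI; (intro lin_fscale lin_eps lin_tproj lin_compose[OF lin_tproj])?; simp)+
  \<comment> \<open>The counit kills every cut whose left part is nonempty, respectively whose right
    part is nonempty, and leaves the whole word.\<close>
  have D: "D fscale (\<lambda>x y. fscale (eps x) (tproj y)) = tproj"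
    by (rule words_ext[OF vsf])
      (simp_all add: tlin_D[OF vsf] b tlin_sh_L D_W[OF vsf b(1)] eps_W cut_left)
  have D': "D fscale (\<lambda>x y. fscale (eps y) (tproj x)) = tproj"
    by (rule words_ext[OF vsf])
      (simp_all add: tlin_D[OF vsf] b tlin_sh_L D_W[OF vsf b(2)] eps_W cut_right)
  have "(\<Sum>(x, y)\<leftarrow>R a. fscale (eps x) y) = (\<Sum>(x, y)\<leftarrow>R a. fscale (eps x) (tproj y))"
    "(\<Sum>(x, y)\<leftarrow>R a. fscale (eps y) x) = (\<Sum>(x, y)\<leftarrow>R a. fscale (eps y) (tproj x))"
    by (rule sum_list_sweedler_cong[OF R a]; simp add: tproj_id)+
  then show "(\<Sum>(x, y)\<leftarrow>R a. fscale (eps x) y) = a" "(\<Sum>(x, y)\<leftarrow>R a. fscale (eps y) x) = a"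
    by (simp_all add: sweedler_sum[OF R vsf b(1) a] sweedler_sum[OF R vsf b(2) a] D D' tproj_id[OF a])
qed

lemma is_unit: "is_unit_of (TV s) (shuffle_prod s) (W [])"
  unfolding is_unit_of_def by (auto simp: sh_eq tproj_id)

lemma bialgebra: "bialgebra fscale (TV s) (shuffle_prod s) (deconc s)"
proof (intro bialgebra.intro bialgebra_axioms.intro vsf subspace_TV)
  show "bilinear_product fscale (TV s) (shuffle_prod s)"
    unfolding bilinear_product_def
    using lin_sh1[OF lin_id] lin_sh2[OF lin_id]
    by (simp add: sh_eq linear_on_def add_in scale_in)
  show "shuffle_prod s (shuffle_prod s a b) c = shuffle_prod s a (shuffle_prod s b c)"
    if "a \<in> TV s" "b \<in> TV s" "c \<in> TV s" for a b c
    using that by (simp add: sh_eq sh_assoc)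
  show "deconc s a \<in> tensor_power fscale (TV s) 2" if a: "a \<in> TV s" for a
  proof -
    have tens2_in: "tens2 x y \<in> tensor_power fscale (TV s) 2" for x y
      unfolding tensor_power_def tens2_def by (rule F.span_base) auto
    \<comment> \<open>The prefix enters through an arbitrary map \<open>h\<close>, since each step
      of the induction prepends a letter to it.\<close>
    have cut_in: "cut (\<lambda>u v. tens2 (h u) (W v)) w \<in> tensor_power fscale (TV s) 2" for h w
    proof (induction w arbitrary: h)
      case Nil
      then show ?case by (simp add: tens2_in)
    next
      case (Cons x w)
      have "tens2 (h []) (W (x # w)) + cut (\<lambda>u v. tens2 (h (x # u)) (W v)) w \<in> tensor_power fscale (TV s) 2"
        using tens2_in Cons[of "\<lambda>u. h (x # u)"] unfolding tensor_power_def by (rule F.span_add)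
      then show ?case by simp
    qed
    from a have "a \<in> module.span fscale (W ` lists UNIV)" unfolding tensor_algebra_def .
    then have "a \<in> TV s \<and> D fscale tens2 a \<in> tensor_power fscale (TV s) 2"
    proof (induction rule: F.span_induct_alt)
      case base
      then show ?case unfolding D_zero[OF vsf bilin_tens2] tensor_power_def by (simp add: F.span_zero)
    next
      case (step c x y)
      then obtain w where w: "x = W w" by auto
      have "D fscale tens2 (fscale c x + y) = fscale c (D fscale tens2 x) + D fscale tens2 y"
        using tlin_lin[OF tlin_D[OF vsf bilin_tens2]] by (simp add: linear_on_def)
      then show ?case
        using step cut_in[of W w] D_W[OF vsf bilin_tens2, of w] unfolding w tensor_power_def
        by (simp add: F.span_add F.span_scale add_in scale_in)
    qed
    then show ?thesis by (simp add: deconc_eq[OF a])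
  qed
  show "linear_on fscale (TV s) fscale (deconc s)"
    using tlin_lin[OF tlin_D[OF vsf bilin_tens2]] by (simp add: linear_on_def deconc_eq add_in scale_in)
  show "(\<Sum>(x, y)\<leftarrow>R a. \<Sum>(u, v)\<leftarrow>R x. tens fscale (TV s) [u, v, y]) =
      (\<Sum>(x, y)\<leftarrow>R a. \<Sum>(u, v)\<leftarrow>R y. tens fscale (TV s) [x, u, v])"
    if R: "sweedler fscale (TV s) (deconc s) R" and a: "a \<in> TV s" for R a
  proof -
    note cong = sum_list_sweedler_cong[OF R]
    \<comment> \<open>The inner sum is itself bilinear in the two factors, so the outer Sweedler sum
      can be evaluated by \<open>sweedler_sum\<close> too.\<close>
    have b1: "bilin fscale (\<lambda>x y. D fscale (\<lambda>u v. tens3 u v y) x)"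
      by (rule bilinI) (auto simp: bilin_tens3 intro!: lin_D vsf bilin_tens3 lin_id
        lin_D_fun[where g = "\<lambda>y u v. tens3 u v y"])
    have b2: "bilin fscale (\<lambda>x y. D fscale (\<lambda>u v. tens3 x u v) y)"
      by (rule bilinI) (auto simp: bilin_tens3 intro!: lin_D vsf bilin_tens3 lin_id
        lin_D_fun[where g = "\<lambda>x u v. tens3 x u v"])
    have "(\<Sum>(x, y)\<leftarrow>R a. \<Sum>(u, v)\<leftarrow>R x. tens fscale (TV s) [u, v, y]) =
        (\<Sum>(x, y)\<leftarrow>R a. D fscale (\<lambda>u v. tens3 u v y) x)"
      by (intro cong a, subst sweedler_sum[OF R vsf bilin_tens3(1), symmetric], assumption, rule cong)
        (simp_all add: tens3_def tproj_id)
    also have "\<dots> = D fscale (\<lambda>x y. D fscale (\<lambda>u v. tens3 u v y) x) a"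
      by (rule sweedler_sum[OF R vsf b1 a])
    also have "\<dots> = D fscale (\<lambda>x y. D fscale (\<lambda>u v. tens3 x u v) y) a"
      by (rule TV_eqI[OF vsf tlin_lin[OF tlin_D[OF vsf b1]] tlin_lin[OF tlin_D[OF vsf b2]] _ a])
        (unfold D_W[OF vsf b1] D_W[OF vsf b2], unfold D_W[OF vsf bilin_tens3(1)] D_W[OF vsf bilin_tens3(2)],
          rule cut_coassoc)
    also have "\<dots> = (\<Sum>(x, y)\<leftarrow>R a. D fscale (\<lambda>u v. tens3 x u v) y)"
      by (rule sweedler_sum[OF R vsf b2 a, symmetric])
    also have "\<dots> = (\<Sum>(x, y)\<leftarrow>R a. \<Sum>(u, v)\<leftarrow>R y. tens fscale (TV s) [x, u, v])"
      by (intro cong a, subst sweedler_sum[OF R vsf bilin_tens3(2), symmetric], assumption, rule cong)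
        (simp_all add: tens3_def tproj_id)
    finally show ?thesis .
  qed
  show "deconc s (shuffle_prod s a b) =
      (\<Sum>(a1, a2)\<leftarrow>R a. \<Sum>(b1, b2)\<leftarrow>R b. tens fscale (TV s) [shuffle_prod s a1 b1, shuffle_prod s a2 b2])"
    if R: "sweedler fscale (TV s) (deconc s) R" and a: "a \<in> TV s" and b: "b \<in> TV s" for R a b
  proof -
    note two = bilin_two_fold[OF vsf bilin_tens2 bilin_sh bilin_sh]
    have "deconc s (shuffle_prod s a b) = D fscale tens2 (sh a b)"
      by (simp add: sh_eq a b deconc_eq)
    also have "\<dots> = (\<Sum>(a1, a2)\<leftarrow>R a. \<Sum>(b1, b2)\<leftarrow>R b. tens2 (sh a1 b1) (sh a2 b2))"
      unfolding D_sh[OF vsf bilin_tens2] sweedler_sum[OF R vsf two(1) b] sweedler_sum[OF R vsf two(2) a] ..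
    also have "\<dots> = (\<Sum>(a1, a2)\<leftarrow>R a. \<Sum>(b1, b2)\<leftarrow>R b.
        tens fscale (TV s) [shuffle_prod s a1 b1, shuffle_prod s a2 b2])"
      by (intro sum_list_sweedler_cong[OF R] a b) (simp add: tens2_def sh_eq)
    finally show ?thesis .
  qed
  show "\<exists>e \<epsilon>. is_unit_of (TV s) (shuffle_prod s) e \<and> is_counit fscale (TV s) (deconc s) \<epsilon> \<and>
      deconc s e = tens fscale (TV s) [e, e] \<and> \<epsilon> e = 1 \<and>
      (\<forall>a\<in>TV s. \<forall>b\<in>TV s. \<epsilon> (shuffle_prod s a b) = \<epsilon> a * \<epsilon> b)"
    by (intro exI[of _ "W []"] exI[of _ eps] conjI is_unit is_counit_eps)
      (simp_all add: deconc_eq D_W[OF vsf bilin_tens2] tens2_def eps_W sh_eq eps_sh)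
qed

section \<open>Projection to degree one and expansion by first letters\<close>

definition letter :: "('k, 'v) functional \<Rightarrow> 'v"
  where "letter = ext s (\<lambda>w. case w of [x] \<Rightarrow> x | _ \<Rightarrow> 0)"

lemma multilin_letter: "multilin s (\<lambda>w. case w of [x] \<Rightarrow> x | _ \<Rightarrow> 0)"
proof (rule multilinI)
  fix us vs
  show "lin s s (\<lambda>z. case us @ z # vs of [x] \<Rightarrow> x | _ \<Rightarrow> 0)"
  proof (cases us)
    case Nil
    then show ?thesis by (cases vs) (simp_all add: lin_id lin_zero[OF vs])
  next
    case (Cons x us')
    then show ?thesis by (cases us') (simp_all add: lin_zero[OF vs])
  qed
qed

lemma lin_letter: "lin fscale s letter"
  unfolding letter_def by (rule lin_ext[OF vs multilin_letter])

lemma letter_W: "letter (W w) = (case w of [x] \<Rightarrow> x | _ \<Rightarrow> 0)"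
  unfolding letter_def by (rule ext_W[OF vs multilin_letter])

lemma letter_tproj [simp]: "letter (tproj p) = letter p"
  by (simp add: letter_def)

lemma letter_add: "letter (p + q) = letter p + letter q"
  and letter_zero: "letter 0 = 0"
proof -
  show add: "letter (p + q) = letter p + letter q" for p q
    using lin_letter by (simp add: linear_on_def)
  show "letter 0 = 0" using add[of 0 0] by simp
qed

lemma letter_L_one: "letter (L x (W [])) = x"
  using letter_W[of "[x]"] by (simp add: W_Cons)

lemma linear_zero_on_tensor_power:
  assumes t: "vector_space t" and F: "lin fscale t F"
    and "\<And>w. length w = n \<Longrightarrow> F (W w) = 0" and p: "p \<in> tensor_power s UNIV n"
  shows "F p = 0"
proof (rule linear_on_span_eqI[OF vsf t, where F = F and G = "\<lambda>_. 0" and x = p])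
  show "p \<in> module.span fscale (W ` {xs \<in> lists UNIV. length xs = n})"
    using p unfolding tensor_power_def .
qed (use assms(3) F lin_zero[OF t, of fscale] in \<open>auto simp: linear_on_def\<close>)

lemma bilin_first_letter: "bilin fscale (\<lambda>p q. L (letter p) q)"
  by (rule bilinI) (auto intro!: lin_L1 lin_L2 lin_letter lin_id)

text \<open>In the deconcatenation of a nonempty word only the cut after the first letter survives
  \<open>letter\<close>; the empty word is covered by the \<open>eps\<close> term.\<close>

lemma first_letter_expansion:
  "tproj p = fscale (eps p) (W []) + D fscale (\<lambda>p q. L (letter p) q) p"
proof -
  have "tproj = (\<lambda>p. fscale (eps p) (W []) + D fscale (\<lambda>p q. L (letter p) q) p)"
  proof (rule words_ext[OF vsf])
    show "tlin fscale (\<lambda>p. fscale (eps p) (W []) + D fscale (\<lambda>p q. L (letter p) q) p)"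
      by (auto simp: tlin_def intro!: lin_add vsf lin_fscale lin_eps lin_D bilin_first_letter lin_id)
    show "tproj (W w) = fscale (eps (W w)) (W []) + D fscale (\<lambda>p q. L (letter p) q) (W w)" for w
    proof (cases w)
      case (Cons x u)
      then show ?thesis
        by (simp add: D_W[OF vsf bilin_first_letter] eps_W letter_W cut_left) (rule W_Cons)
    qed (simp add: D_W[OF vsf bilin_first_letter] eps_W letter_W)
  qed (simp add: tlin_sh_L)
  then show ?thesis by (rule fun_cong)
qed

end


section \<open>The product defined by \<open>star\<close> and \<open>brk\<close>\<close>

locale tensor_words_products = tensor_words s
  for s :: "'k::field_char_0 \<Rightarrow> 'v::ab_group_add \<Rightarrow> 'v" +
  fixes star brk :: "'v \<Rightarrow> 'v \<Rightarrow> 'v"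
  assumes bilinear_star: "bilinear_product s UNIV star"
    and bilinear_brk: "bilinear_product s UNIV brk"
begin

lemma lin_star: "lin s s (star x)" "lin s s (\<lambda>x. star x y)"
  and lin_brk: "lin s s (brk x)" "lin s s (\<lambda>x. brk x y)"
  using bilinear_star bilinear_brk by (simp_all add: bilinear_product_def)

section \<open>Recursion for the product on words\<close>

lemma L_sum: "L x (\<Sum>i<(n::nat). f i) = (\<Sum>i<n. L x (f i))"
  by (induction n) (simp_all only: sum.lessThan_Suc lessThan_0 sum.empty L_add L_zero)

lemma bullet_words_Nil: "bullet_words s star brk [] ys = 0"
  by (simp only: bullet_words_def list.size lessThan_0 sum.empty add_0 if_cancel diff_0_eq_0)

text \<open>Index 0 of each sum gives a \<open>G\<close> term, and all later indices carry the
  prefix \<open>x\<close>. \<open>G\<close> is 0 on the empty word, which matches the case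
  \<open>ys = []\<close> and the missing last index of the second sum.\<close>

lemma bullet_words_Cons:
  "bullet_words s star brk (x # u) ys =
    L x (bullet_words s star brk u ys) + G (star x) (W ys) (W u) + G (brk x) (W u) (W ys)"
proof -
  have 1: "(if ys = [] then 0 else \<Sum>i<length (x # u). \<Sum>w\<leftarrow>shuf (drop (i + 1) (x # u)) (tl ys).
      W (take i (x # u) @ star ((x # u) ! i) (hd ys) # w)) =
    L x (if ys = [] then 0 else \<Sum>i<length u. \<Sum>w\<leftarrow>shuf (drop (i + 1) u) (tl ys).
      W (take i u @ star (u ! i) (hd ys) # w)) + G (star x) (W ys) (W u)"
  proof (cases ys)
    case Nil
    then show ?thesis by (simp only: G_one[OF lin_star(1)] L_zero add_0 if_True simp_thms)
  next
    case (Cons y v)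
    have "G (star x) (W ys) (W u) = L (star x y) (sh (W u) (W v))"
      by (simp only: Cons W_Cons G_L[OF lin_star(1)] sh_commute[of "W v"])
    also have "\<dots> = (\<Sum>w\<leftarrow>shuf u v. W (star x y # w))"
      by (simp only: sh_W L_sum_list W_Cons)
    finally have G: "G (star x) (W (y # v)) (W u) = (\<Sum>w\<leftarrow>shuf u v. W (star x y # w))"
      by (simp only: Cons)
    show ?thesis
      by (simp only: Cons length_Cons sum.lessThan_Suc_shift list.distinct if_False L_sum L_sum_list
        G list.sel take_0 drop_0 take_Suc_Cons drop_Suc_Cons append.simps nth_Cons_0
        nth_Cons_Suc add_Suc One_nat_def plus_nat.add_0 W_Cons[of x]) (rule add.commute)
  qed
  have 2: "(\<Sum>i<length (x # u) - 1. \<Sum>w\<leftarrow>shuf (drop (i + 2) (x # u)) ys.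
      W (take i (x # u) @ brk ((x # u) ! i) ((x # u) ! (i + 1)) # w)) =
    L x (\<Sum>i<length u - 1. \<Sum>w\<leftarrow>shuf (drop (i + 2) u) ys.
      W (take i u @ brk (u ! i) (u ! (i + 1)) # w)) + G (brk x) (W u) (W ys)"
  proof (cases u)
    case Nil
    then show ?thesis
      by (simp only: G_one[OF lin_brk(1)] L_zero add_0 list.size lessThan_0 sum.empty add_Suc
        diff_0_eq_0 diff_self_eq_0 One_nat_def plus_nat.add_0)
  next
    case (Cons z v)
    have "G (brk x) (W u) (W ys) = L (brk x z) (sh (W v) (W ys))"
      by (simp only: Cons W_Cons G_L[OF lin_brk(1)])
    also have "\<dots> = (\<Sum>w\<leftarrow>shuf v ys. W (brk x z # w))"
      by (simp only: sh_W L_sum_list W_Cons)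
    finally have G: "G (brk x) (W (z # v)) (W ys) = (\<Sum>w\<leftarrow>shuf v ys. W (brk x z # w))"
      by (simp only: Cons)
    show ?thesis
      by (simp only: Cons length_Cons diff_Suc_Suc diff_zero One_nat_def sum.lessThan_Suc_shift L_sum L_sum_list
        G take_0 drop_0 take_Suc_Cons drop_Suc_Cons append.simps nth_Cons_0
        nth_Cons_Suc add_Suc plus_nat.add_0 numeral_2_eq_2 W_Cons[of x]) (rule add.commute)
  qed
  show ?thesis unfolding bullet_words_def 1 2 L_add by (simp only: add_ac)
qed

lemma multilin_bullet_words:
  "multilin fscale (bullet_words s star brk xs)"
  "multilin fscale (\<lambda>xs. bullet_words s star brk xs ys)"
proof -
  have "lin s fscale (\<lambda>z. bullet_words s star brk xs (us @ z # vs))" for us vs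
  proof (induction xs)
    case Nil
    show ?case unfolding bullet_words_Nil by (rule lin_zero[OF vsf])
  next
    case (Cons x xs)
    then show ?case
      unfolding bullet_words_Cons
      by (intro lin_intros lin_G1 lin_G2 lin_star lin_brk multilin_lin[OF multilin_W])
  qed
  then show "multilin fscale (bullet_words s star brk xs)" by (rule multilinI)
  have "lin s fscale (\<lambda>z. bullet_words s star brk (us @ z # vs) ys)" for us vs
  proof (induction us)
    case Nil
    show ?case
      unfolding append_Nil bullet_words_Cons
      by (intro lin_intros lin_G0 lin_star lin_brk)
  next
    case (Cons x us)
    then show ?case
      unfolding append_Cons bullet_words_Cons
      by (intro lin_intros lin_G1 lin_G2 lin_star lin_brk multilin_lin[OF multilin_W])
  qed
  then show "multilin fscale (\<lambda>xs. bullet_words s star brk xs ys)" by (rule multilinI)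
qed

definition bu :: "('k, 'v) functional \<Rightarrow> ('k, 'v) functional \<Rightarrow> ('k, 'v) functional"
  where "bu p q = ext fscale (\<lambda>xs. ext fscale (bullet_words s star brk xs) q) p"

lemma bu_eq: "p \<in> TV s \<Longrightarrow> q \<in> TV s \<Longrightarrow> bullet s star brk p q = bu p q"
  by (simp add: bullet_def bu_def ext_def tproj_id)

lemma bu_tproj [simp]: "bu (tproj p) q = bu p q" "bu p (tproj q) = bu p q"
  by (simp_all add: bu_def)

lemma multilin_bu: "multilin fscale (\<lambda>xs. ext fscale (bullet_words s star brk xs) q)"
proof (rule multilinI)
  fix us vs
  show "lin s fscale (\<lambda>z. ext fscale (bullet_words s star brk (us @ z # vs)) q)"
    by (rule lin_ext_fun[where f = "\<lambda>z. bullet_words s star brk (us @ z # vs)"])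
      (rule vsf multilin_bullet_words(1)
        multilin_lin[where f = "\<lambda>xs. bullet_words s star brk xs ys" for ys, OF multilin_bullet_words(2)])+
qed

lemma lin_bu1: "lin r fscale h \<Longrightarrow> lin r fscale (\<lambda>p. bu (h p) q)"
  unfolding bu_def by (rule lin_compose[OF lin_ext[OF vsf multilin_bu]])

lemma lin_bu2: "lin r fscale h \<Longrightarrow> lin r fscale (\<lambda>q. bu p (h q))"
  unfolding bu_def
  by (rule lin_compose[where q = fscale and h = h],
      rule lin_ext_fun[where f = "\<lambda>q xs. ext fscale (bullet_words s star brk xs) q"])
    (rule vsf multilin_bu lin_ext multilin_bullet_words(1) | assumption)+

lemma bu_W: "bu (W xs) (W ys) = bullet_words s star brk xs ys"
  by (simp add: bu_def ext_W[OF vsf] multilin_bu multilin_bullet_words)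

lemma bu_add [simp]: "bu (p + q) r = bu p r + bu q r" "bu r (p + q) = bu r p + bu r q"
  and bu_zero [simp]: "bu 0 r = 0" "bu r 0 = 0"
proof -
  show 1: "bu (p + q) r = bu p r + bu q r" for p q
    using lin_bu1[OF lin_id, of r] by (simp add: linear_on_def)
  show 2: "bu r (p + q) = bu r p + bu r q" for p q
    using lin_bu2[OF lin_id, of r] by (simp add: linear_on_def)
  show "bu 0 r = 0" "bu r 0 = 0" using 1[of 0 0] 2[of 0 0] by simp_all
qed

lemma bilin_bu: "bilin fscale bu"
  by (rule bilinI) (auto intro!: lin_bu1 lin_bu2 lin_id)

lemma bu_in [simp]: "bu p q \<in> TV s"
proof -
  have "G f p q \<in> TV s" if "lin s s f" for f p q
    unfolding G_def
    by (rule ext_in[OF multilin_G[OF that]]) (auto split: list.split)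
  then have "bullet_words s star brk xs ys \<in> TV s" for xs ys
    by (induction xs) (auto simp: bullet_words_Nil bullet_words_Cons intro!: add_in lin_star lin_brk)
  then show ?thesis
    unfolding bu_def by (intro ext_in multilin_bu multilin_bullet_words(1))
qed

lemma bu_one [simp]: "bu (W []) q = 0"
proof -
  have "bu (W []) = (\<lambda>q. 0)"
    by (rule words_ext[OF vsf])
      (auto simp only: tlin_def bu_W bullet_words_Nil bu_tproj intro!: lin_bu2 lin_id lin_zero vsf)
  from fun_cong[OF this, of q] show ?thesis .
qed

lemma bu_L: "bu (L x p) q = L x (bu p q) + G (star x) q p + G (brk x) p q"
proof -
  note intros = lin_intros lin_bu1 lin_bu2 lin_G1 lin_G2 lin_star lin_brk
  have 1: "(\<lambda>p. bu (L x p) (W w)) = (\<lambda>p. L x (bu p (W w)) + G (star x) (W w) p + G (brk x) p (W w))" for w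
  proof (rule words_ext[OF vsf])
    show "bu (L x (W v)) (W w) = L x (bu (W v) (W w)) + G (star x) (W w) (W v) + G (brk x) (W v) (W w)"
      for v
      unfolding W_Cons[symmetric] bu_W bullet_words_Cons ..
  qed (auto simp: tlin_def intro!: intros)
  have "(\<lambda>q. bu (L x p) q) = (\<lambda>q. L x (bu p q) + G (star x) q p + G (brk x) p q)"
    by (rule words_ext[OF vsf]) (auto simp: tlin_def fun_cong[OF 1] intro!: intros)
  then show ?thesis by (rule fun_cong)
qed

text \<open>Induction with varying test map, based on \<open>bu_L\<close>. The three boundary terms
  with \<open>W []\<close> assemble to the empty left part of the first sum; in the double sum an
  empty \<open>a1\<close> contributes 0.\<close>

lemma D_bu_W:
  assumes t: "vector_space t"
  shows "bilin t g \<Longrightarrow> D t g (bu (W a) (W b)) = cut (\<lambda>a1 a2. g (W a1) (bu (W a2) (W b))) a +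
    cut (\<lambda>a1 a2. cut (\<lambda>b1 b2. g (bu (W a1) (W b1)) (sh (W a2) (W b2))) b) a"
proof (induction a arbitrary: g)
  case Nil
  then show ?case by (simp add: D_zero[OF t] bilin_zero cut_zero)
next
  case (Cons x u)
  note g = Cons.prems
  note IH = Cons.IH[OF bilin_L[OF g], of x]
  \<comment> \<open>The first letter is taken from \<open>b\<close>, so \<open>D_G_W\<close> cuts
    \<open>b\<close> outside and \<open>u\<close> inside; the two sums are exchanged to match the
    claim.\<close>
  have star: "D t g (G (star x) (W b) (W u)) = g (W []) (G (star x) (W b) (W u)) +
    cut (\<lambda>a1 a2. cut (\<lambda>b1 b2. g (G (star x) (W b1) (W a1)) (sh (W a2) (W b2))) b) u"
    unfolding D_G_W[OF t g lin_star(1)] by (subst cut_swap) (simp only: sh_commute)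
  show ?case
    by (simp add: W_Cons bu_L IH star D_G_W[OF t g lin_brk(1)] D_add[OF t g] D_L[OF t g]
      bilin_add[OF g] bilin_zero[OF g] cut_add cut_zero add_ac)
qed

lemma D_bu:
  assumes t: "vector_space t" and g: "bilin t g"
  shows "D t g (bu p q) = D t (\<lambda>p1 p2. g p1 (bu p2 q)) p +
    D t (\<lambda>p1 p2. D t (\<lambda>q1 q2. g (bu p1 q1) (sh p2 q2)) q) p"
    and "bilin t (\<lambda>p1 p2. g p1 (bu p2 q))"
proof -
  note two = bilin_two_fold[OF t g bilin_bu bilin_sh]
  show one: "bilin t (\<lambda>p1 p2. g p1 (bu p2 q))" for q
    by (rule bilinI; (intro bilin_lin1[OF g] bilin_lin2[OF g] lin_bu1 lin_id)?; simp add: bilin_tproj[OF g])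
  have lin: "lin fscale t (\<lambda>q. D t (\<lambda>p1 p2. g p1 (bu p2 q)) p)" for p
    by (rule lin_D_fun[where g = "\<lambda>q p1 p2. g p1 (bu p2 q)", OF t one])
      (intro bilin_lin2[OF g] lin_bu2 lin_id)
  have 1: "(\<lambda>p. D t g (bu p (W b))) = (\<lambda>p. D t (\<lambda>p1 p2. g p1 (bu p2 (W b))) p +
    D t (\<lambda>p1 p2. D t (\<lambda>q1 q2. g (bu p1 q1) (sh p2 q2)) (W b)) p)" for b
  proof (rule words_ext[OF t])
    show "tlin t (\<lambda>p. D t g (bu p (W b)))"
      by (simp add: tlin_def lin_D[OF t g lin_bu1[OF lin_id]])
    show "tlin t (\<lambda>p. D t (\<lambda>p1 p2. g p1 (bu p2 (W b))) p +
        D t (\<lambda>p1 p2. D t (\<lambda>q1 q2. g (bu p1 q1) (sh p2 q2)) (W b)) p)"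
      by (auto simp: tlin_def intro!: lin_add[OF t] lin_D t one two(2) lin_id)
  qed (simp only: D_two_fold_W[OF t g bilin_bu bilin_sh] D_bu_W[OF t g] D_W[OF t one])
  have 2: "(\<lambda>q. D t g (bu p q)) = (\<lambda>q. D t (\<lambda>p1 p2. g p1 (bu p2 q)) p +
    D t (\<lambda>p1 p2. D t (\<lambda>q1 q2. g (bu p1 q1) (sh p2 q2)) q) p)"
    by (rule words_ext[OF t])
      (simp_all add: fun_cong[OF 1] tlin_def lin_D[OF t g lin_bu2[OF lin_id]] lin_add[OF t lin two(3)])
  show "D t g (bu p q) = D t (\<lambda>p1 p2. g p1 (bu p2 q)) p +
    D t (\<lambda>p1 p2. D t (\<lambda>q1 q2. g (bu p1 q1) (sh p2 q2)) q) p"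
    by (rule fun_cong[OF 2])
qed

end

section \<open>Leibniz rule and pre-Lie identity\<close>

locale compatible_tensor_words_products = tensor_words_products s star brk
  for s :: "'k::field_char_0 \<Rightarrow> 'v::ab_group_add \<Rightarrow> 'v" and star brk +
  assumes compatible: "compatible_products s star brk"
begin

lemma star_prelie: "star (star x y) z + star x (star z y) = star (star x z) y + star x (star y z)"
  and brk_antisym: "brk x y = - brk y x"
  and star_brk: "star x (brk y z) = brk (star x y) z"
  and brk_star: "star (brk x y) z = brk (star x z) y + brk x (star y z) + brk (brk x y) z"
proof -
  note c = compatible[unfolded compatible_products_def]
  have 1: "\<forall>x y z. star (star x y) z - star x (star y z) = star (star x z) y - star x (star z y)"
    and 2: "\<forall>x y. brk x y = - brk y x" and 3: "\<forall>x y z. star x (brk y z) = brk (star x y) z"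
    and 4: "\<forall>x y z. star (brk x y) z = brk (star x z) y + brk x (star y z) + brk (brk x y) z"
    using c by - (elim conjE, assumption)+
  show "star (star x y) z + star x (star z y) = star (star x z) y + star x (star y z)"
    using 1[rule_format, of x y z] by (simp add: diff_eq_eq diff_add_eq)
  show "brk x y = - brk y x" by (rule 2[rule_format])
  show "star x (brk y z) = brk (star x y) z" by (rule 3[rule_format])
  show "star (brk x y) z = brk (star x z) y + brk x (star y z) + brk (brk x y) z"
    by (rule 4[rule_format])
qed

text \<open>After expansion by the recursions the only terms without a partner on the other side are
  those joining the first letters of the two words, {x, y} and {y, x}; antisymmetry cancels
  them.\<close>

lemma leibniz_W: "bu (sh (W a) (W b)) (W c) = sh (bu (W a) (W c)) (W b) + sh (bu (W b) (W c)) (W a)"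
proof (induction "length a + length b" arbitrary: a b rule: less_induct)
  case less
  consider "a = []" | "b = []" | x u y v where "a = x # u" "b = y # v"
    by (metis list.exhaust)
  then show ?case
  proof cases
    case 3
    note [simp] = 3
    have "L x (bu (sh (W u) (W b)) (W c)) = L x (sh (bu (W u) (W c)) (W b) + sh (bu (W b) (W c)) (W u))"
      "L y (bu (sh (W a) (W v)) (W c)) = L y (sh (bu (W a) (W c)) (W v) + sh (bu (W v) (W c)) (W a))"
      by (rule arg_cong[where f = "L _"], rule less; simp)+
    \<comment> \<open>The letter following \<open>x\<close> in the shuffle is the first letter of
      \<open>u\<close> or the letter \<open>y\<close>; the last summand is the cross term.\<close>
    moreover have "G (brk x) (sh (W u) (W b)) (W c) =
       G (brk x) (W u) (sh (W b) (W c)) + L (brk x y) (sh (W u) (sh (W v) (W c)))"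
      unfolding G_sh[OF lin_brk(1)] by (simp add: W_Cons G_L[OF lin_brk(1)] sh_ac)
    moreover have "G (brk y) (sh (W a) (W v)) (W c) =
       G (brk y) (W v) (sh (W a) (W c)) - L (brk x y) (sh (W u) (sh (W v) (W c)))"
      unfolding G_sh[OF lin_brk(1)]
      by (simp add: W_Cons G_L[OF lin_brk(1)] sh_ac brk_antisym[of y x] L_minus_left)
    \<comment> \<open>The ordering of shuffles may put the factor \<open>L\<close> on the left, so
      \<open>sh_G_L\<close> is supplied in commuted form as well.\<close>
    ultimately show ?thesis
      by (simp add: W_Cons sh_L_L bu_L sh_G_L[OF lin_star(1)] sh_G_L[OF lin_brk(1)]
        sh_G_L[OF lin_star(1), unfolded sh_commute[of "G _ _ _" "L _ _"]]
        sh_G_L[OF lin_brk(1), unfolded sh_commute[of "G _ _ _" "L _ _"]] sh_ac add_ac)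
  qed (simp_all add: tproj_id)
qed

lemma leibniz: "bu (sh p q) r = sh (bu p r) q + sh (bu q r) p"
proof -
  note intros = lin_intros lin_bu1 lin_bu2
  have 1: "(\<lambda>p. bu (sh p (W b)) (W c)) = (\<lambda>p. sh (bu p (W c)) (W b) + sh (bu (W b) (W c)) p)" for b c
    by (rule words_ext[OF vsf]) (auto simp: tlin_def leibniz_W intro!: intros)
  have 2: "(\<lambda>q. bu (sh p q) (W c)) = (\<lambda>q. sh (bu p (W c)) q + sh (bu q (W c)) p)" for c
    by (rule words_ext[OF vsf]) (auto simp: tlin_def fun_cong[OF 1] intro!: intros)
  have 3: "(\<lambda>r. bu (sh p q) r) = (\<lambda>r. sh (bu p r) q + sh (bu q r) p)"
    by (rule words_ext[OF vsf]) (auto simp: tlin_def fun_cong[OF 2] intro!: intros)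
  show ?thesis by (rule fun_cong[OF 3])
qed

lemma L_diff_left: "L (x - y) p = L x p - L y p"
  using L_add_left[of x "- y" p] by (simp add: L_minus_left)

text \<open>
  The part of the pre-Lie identity for a left word \<open>x # u\<close> that does not come from the
  identity for \<open>u\<close>.
\<close>

lemma prelie_step:
  fixes x u
  defines "R \<equiv> \<lambda>b c. G (star x) (W c) (bu (W u) (W b)) + G (brk x) (bu (W u) (W b)) (W c) +
    bu (G (star x) (W b) (W u)) (W c) + bu (G (brk x) (W u) (W b)) (W c) +
    G (star x) (bu (W c) (W b)) (W u) + G (brk x) (W u) (bu (W c) (W b))"
  shows "R b c = R c b"
proof -
  \<comment> \<open>The pre-Lie identity is symmetric in \<open>w\<close> and \<open>y\<close> and
    would loop as a general rewrite rule; it is solved for one order and later instantiated to the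
    first letters of \<open>c\<close> and \<open>b\<close>.\<close>
  have star_star: "star (star x w) y = star (star x y) w + star x (star w y) - star x (star y w)" for w y
    using star_prelie[of x w y] by (simp add: algebra_simps)
  note simps = W_Cons bu_L G_L[OF lin_star(1)] G_L[OF lin_brk(1)] G_one[OF lin_star(1)]
    G_one[OF lin_brk(1)] G_add[OF lin_star(1)] G_add[OF lin_brk(1)] G_sh[OF lin_brk(1)]
    G_G[OF lin_star(1) lin_brk(1)] G_G[OF lin_brk(1) lin_brk(1)] leibniz star_brk
    brk_star L_add_left L_diff_left sh_ac
  \<comment> \<open>Separating empty from nonempty words exposes the first letters;
    \<open>star_star\<close> enters only when \<open>b\<close> and \<open>c\<close> are both
    nonempty.\<close>
  show ?thesis
  proof (cases b)
    case Nil
    then show ?thesis unfolding R_def by (cases c; cases u) (simp_all add: simps)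
  next
    case b: (Cons y b')
    show ?thesis
    proof (cases c)
      case Nil
      then show ?thesis unfolding R_def by (cases u) (simp_all add: b simps)
    next
      case (Cons w c')
      then show ?thesis unfolding R_def by (cases u) (simp_all add: b simps star_star[of w y])
    qed
  qed
qed

text \<open>Written without subtraction, so that regrouping by \<open>add_ac\<close> suffices. The
  induction step adds \<open>prelie_step\<close> to the hypothesis prefixed with
  \<open>x\<close>.\<close>

lemma prelie_W:
  "bu (bu (W a) (W b)) (W c) + bu (W a) (bu (W c) (W b)) =
    bu (bu (W a) (W c)) (W b) + bu (W a) (bu (W b) (W c))"
proof (induction a)
  case (Cons x u)
  have IH: "L x (bu (bu (W u) (W b)) (W c)) + L x (bu (W u) (bu (W c) (W b))) =
    L x (bu (bu (W u) (W c)) (W b)) + L x (bu (W u) (bu (W b) (W c)))"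
    unfolding L_add[symmetric] Cons.IH ..
  \<comment> \<open>The letters \<open>r\<close> stand for the four terms of the hypothesis, the
    others for the terms of \<open>prelie_step\<close>.\<close>
  have "r1 + (p1 + q1 + s1 + t1) + (r2 + m1 + n1) = r3 + (p2 + q2 + s2 + t2) + (r4 + m2 + n2)"
    if "r1 + r2 = r3 + r4" "p1 + q1 + s1 + t1 + m1 + n1 = p2 + q2 + s2 + t2 + m2 + n2"
    for r1 p1 q1 s1 t1 r2 m1 n1 r3 p2 q2 s2 t2 r4 m2 n2 :: "('k, 'v) functional"
    using arg_cong2[OF that, of "(+)"] by (simp only: add_ac)
  from this[OF IH prelie_step[of x c u b]] show ?case
    unfolding W_Cons bu_L bu_add by (simp only: add_ac)
qed simp

lemma prelie:
  "bu (bu p q) r + bu p (bu r q) = bu (bu p r) q + bu p (bu q r)"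
proof -
  note intros = lin_add[OF vsf] lin_bu1 lin_bu2 lin_id
  have 1: "(\<lambda>p. bu (bu p (W b)) (W c) + bu p (bu (W c) (W b))) =
      (\<lambda>p. bu (bu p (W c)) (W b) + bu p (bu (W b) (W c)))" for b c
    by (rule words_ext[OF vsf]) (auto simp: tlin_def prelie_W intro!: intros)
  have 2: "(\<lambda>q. bu (bu p q) (W c) + bu p (bu (W c) q)) =
      (\<lambda>q. bu (bu p (W c)) q + bu p (bu q (W c)))" for c
    by (rule words_ext[OF vsf]) (auto simp: tlin_def fun_cong[OF 1] intro!: intros)
  have 3: "(\<lambda>r. bu (bu p q) r + bu p (bu r q)) = (\<lambda>r. bu (bu p r) q + bu p (bu q r))"
    by (rule words_ext[OF vsf]) (auto simp: tlin_def fun_cong[OF 2] intro!: intros)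
  show ?thesis by (rule fun_cong[OF 3])
qed

theorem com_prelie_bialgebra_bullet:
  "com_prelie_bialgebra fscale (TV s) (shuffle_prod s) (bullet s star brk) (deconc s)"
proof -
  interpret B: bialgebra fscale "TV s" "shuffle_prod s" "deconc s"
    by (rule bialgebra)
  show ?thesis
  proof (intro com_prelie_bialgebra.intro unitary_com_prelie_algebra.intro
      unitary_com_prelie_algebra_axioms.intro com_prelie_algebra.intro com_prelie_algebra_axioms.intro
      com_prelie_bialgebra_axioms.intro bialgebra vsf subspace_TV B.bilinear_dot B.dot_assoc)
    show "bilinear_product fscale (TV s) (bullet s star brk)"
      unfolding bilinear_product_def
      using lin_bu1[OF lin_id] lin_bu2[OF lin_id]
      by (simp add: bu_eq linear_on_def add_in scale_in)
    show "shuffle_prod s a b = shuffle_prod s b a" if "a \<in> TV s" "b \<in> TV s" for a b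
      using that by (simp add: sh_eq sh_commute)
    show "bullet s star brk (bullet s star brk a b) c - bullet s star brk a (bullet s star brk b c) =
        bullet s star brk (bullet s star brk a c) b - bullet s star brk a (bullet s star brk c b)"
      if "a \<in> TV s" "b \<in> TV s" "c \<in> TV s" for a b c
      using that prelie[of a b c] by (simp add: bu_eq algebra_simps)
    show "bullet s star brk (shuffle_prod s a b) c =
        shuffle_prod s (bullet s star brk a c) b + shuffle_prod s a (bullet s star brk b c)"
      if "a \<in> TV s" "b \<in> TV s" "c \<in> TV s" for a b c
      using that by (simp add: bu_eq sh_eq leibniz sh_commute[of a])
    show "\<exists>e. is_unit_of (TV s) (shuffle_prod s) e" using is_unit by blast
    show "deconc s (bullet s star brk a b) =
        (\<Sum>(a1, a2)\<leftarrow>R a. tens fscale (TV s) [a1, bullet s star brk a2 b]) +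
        (\<Sum>(a1, a2)\<leftarrow>R a. \<Sum>(b1, b2)\<leftarrow>R b.
          tens fscale (TV s) [bullet s star brk a1 b1, shuffle_prod s a2 b2])"
      if R: "sweedler fscale (TV s) (deconc s) R" and a: "a \<in> TV s" and b: "b \<in> TV s" for R a b
    proof -
      note two = bilin_two_fold[OF vsf bilin_tens2 bilin_bu bilin_sh]
      have "deconc s (bullet s star brk a b) = D fscale tens2 (bu a b)"
        by (simp add: bu_eq a b deconc_eq)
      also have "\<dots> = (\<Sum>(a1, a2)\<leftarrow>R a. tens2 a1 (bu a2 b)) +
          (\<Sum>(a1, a2)\<leftarrow>R a. \<Sum>(b1, b2)\<leftarrow>R b. tens2 (bu a1 b1) (sh a2 b2))"
        unfolding D_bu(1)[OF vsf bilin_tens2] sweedler_sum[OF R vsf two(1) b] sweedler_sum[OF R vsf two(2) a]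
          sweedler_sum[OF R vsf D_bu(2)[OF vsf bilin_tens2] a] ..
      also have "(\<Sum>(a1, a2)\<leftarrow>R a. tens2 a1 (bu a2 b)) =
          (\<Sum>(a1, a2)\<leftarrow>R a. tens fscale (TV s) [a1, bullet s star brk a2 b])"
        by (intro sum_list_sweedler_cong[OF R] a) (simp add: tens2_def bu_eq b tproj_id)
      also have "(\<Sum>(a1, a2)\<leftarrow>R a. \<Sum>(b1, b2)\<leftarrow>R b. tens2 (bu a1 b1) (sh a2 b2)) =
          (\<Sum>(a1, a2)\<leftarrow>R a. \<Sum>(b1, b2)\<leftarrow>R b.
            tens fscale (TV s) [bullet s star brk a1 b1, shuffle_prod s a2 b2])"
        by (intro sum_list_sweedler_cong[OF R] a b) (simp add: tens2_def sh_eq bu_eq tproj_id)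
      finally show ?thesis .
    qed
  qed
qed

end


section \<open>Homogeneous products of degree minus one\<close>

locale homogeneous_com_prelie_bialgebra = tensor_words s
  for s :: "'k::field_char_0 \<Rightarrow> 'v::ab_group_add \<Rightarrow> 'v" +
  fixes bul
  assumes com_prelie_bialgebra: "com_prelie_bialgebra fscale (TV s) (shuffle_prod s) bul (deconc s)"
    and homogeneous: "homogeneous_minus_one s bul"
begin

interpretation C: com_prelie_bialgebra fscale "TV s" "shuffle_prod s" bul "deconc s"
  by (rule com_prelie_bialgebra)

section \<open>Consequences of homogeneity and of the coproduct formula\<close>

definition pbul :: "('k, 'v) functional \<Rightarrow> ('k, 'v) functional \<Rightarrow> ('k, 'v) functional"
  where "pbul p q = bul (tproj p) (tproj q)"

lemma pbul_in [simp]: "pbul p q \<in> TV s"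
  using C.bilinear_bul by (simp add: pbul_def bilinear_product_def)

lemma bilin_pbul: "bilin fscale pbul"
  using C.bilinear_bul lin_tproj
  by (intro bilinI) (simp_all add: pbul_def bilinear_product_def linear_on_def)

text \<open>Since the unit is its own square, the Leibniz rule makes 1 . q equal to twice
  itself.\<close>

lemma pbul_one: "pbul (W []) q = 0"
proof -
  have "bul (shuffle_prod s (W []) (W [])) (tproj q) =
      shuffle_prod s (bul (W []) (tproj q)) (W []) + shuffle_prod s (W []) (bul (W []) (tproj q))"
    by (rule C.leibniz) simp_all
  moreover have "bul (W []) (tproj q) = pbul (W []) q"
    by (simp add: pbul_def)
  ultimately show ?thesis by (simp add: sh_eq tproj_id)
qed

text \<open>Homogeneity in dual form. Adding 1 on the left avoids truncated subtraction: for two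
  empty words the condition on \<open>F\<close> is void, and the product is 0.\<close>

lemma pbul_degree:
  assumes t: "vector_space t" and F: "lin fscale t F"
    and "\<And>w. length w + 1 = length u + length v \<Longrightarrow> F (W w) = 0"
  shows "F (pbul (W u) (W v)) = 0"
proof -
  have W: "W w \<in> tensor_power s UNIV (length w)" for w
    unfolding tensor_power_def by (rule F.span_base) auto
  have *: "pbul (W u) (W v) \<in>
      (if length u + length v = 0 then {0} else tensor_power s UNIV (length u + length v - 1))"
    using homogeneous[unfolded homogeneous_minus_one_def, rule_format, OF W W]
    unfolding pbul_def tproj_W .
  show ?thesis
  proof (cases "length u + length v = 0")
    case True
    interpret t: vector_space t by fact
    have "F 0 = 0" using F[unfolded linear_on_def] by (metis UNIV_I add_cancel_right_right)
    with * True show ?thesis by simp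
  next
    case False
    with * have "pbul (W u) (W v) \<in> tensor_power s UNIV (length u + length v - 1)"
      by (simp only: if_False)
    from linear_zero_on_tensor_power[OF t F _ this] assms(3) False show ?thesis by simp
  qed
qed

lemma letter_pbul: "length u + length v \<noteq> 2 \<Longrightarrow> letter (pbul (W u) (W v)) = 0"
  by (rule pbul_degree[OF vs lin_letter]) (auto simp: letter_W split: list.split)

text \<open>One Sweedler representative, which exists by \<open>sweedler_exists\<close>, gives the
  formula in the tensor square; the linear map induced by \<open>g\<close> carries it to the target
  of \<open>g\<close>.\<close>

lemma D_pbul_W:
  assumes t: "vector_space t" and g: "bilin t g"
  shows "D t g (pbul (W u) (W v)) = cut (\<lambda>a1 a2. g (W a1) (pbul (W a2) (W v))) u +
    cut (\<lambda>a1 a2. cut (\<lambda>b1 b2. g (pbul (W a1) (W b1)) (sh (W a2) (W b2))) v) u"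
proof -
  note two = bilin_two_fold[OF vsf bilin_tens2 bilin_pbul bilin_sh]
  have one: "bilin fscale (\<lambda>p1 p2. tens2 p1 (pbul p2 (W v)))"
    by (rule bilinI; (intro bilin_lin1[OF bilin_tens2] bilin_lin2[OF bilin_tens2] bilin_lin1[OF bilin_pbul] lin_id)?;
        simp add: bilin_tproj[OF bilin_tens2] bilin_tproj[OF bilin_pbul])
  obtain R where R: "sweedler fscale (TV s) (deconc s) R"
    using sweedler_exists[OF vsf subspace_TV] C.coproduct_closed by blast
  have "D fscale tens2 (pbul (W u) (W v)) = deconc s (bul (W u) (W v))"
    using deconc_eq[OF pbul_in[of "W u" "W v"]] by (simp add: pbul_def)
  also have "\<dots> = (\<Sum>(a1, a2)\<leftarrow>R (W u). tens fscale (TV s) [a1, bul a2 (W v)]) +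
      (\<Sum>(a1, a2)\<leftarrow>R (W u). \<Sum>(b1, b2)\<leftarrow>R (W v). tens fscale (TV s) [bul a1 b1, shuffle_prod s a2 b2])"
    by (rule C.coproduct_bul[OF R]) simp_all
  also have "(\<Sum>(a1, a2)\<leftarrow>R (W u). tens fscale (TV s) [a1, bul a2 (W v)]) =
      (\<Sum>(a1, a2)\<leftarrow>R (W u). tens2 a1 (pbul a2 (W v)))"
    by (intro sum_list_sweedler_cong[OF R] W_in) (simp add: tens2_def tproj_id, simp add: pbul_def tproj_id)
  also have "\<dots> = cut (\<lambda>a1 a2. tens2 (W a1) (pbul (W a2) (W v))) u"
    unfolding sweedler_sum[OF R vsf one W_in] D_W[OF vsf one] ..
  also have "(\<Sum>(a1, a2)\<leftarrow>R (W u). \<Sum>(b1, b2)\<leftarrow>R (W v).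
        tens fscale (TV s) [bul a1 b1, shuffle_prod s a2 b2]) =
      (\<Sum>(a1, a2)\<leftarrow>R (W u). \<Sum>(b1, b2)\<leftarrow>R (W v). tens2 (pbul a1 b1) (sh a2 b2))"
    by (intro sum_list_sweedler_cong[OF R] W_in) (simp add: tens2_def tproj_id sh_eq, simp add: pbul_def tproj_id)
  also have "\<dots> = cut (\<lambda>a1 a2. cut (\<lambda>b1 b2. tens2 (pbul (W a1) (W b1)) (sh (W a2) (W b2))) v) u"
    unfolding sweedler_sum[OF R vsf two(1) W_in] sweedler_sum[OF R vsf two(2) W_in]
      D_two_fold_W[OF vsf bilin_tens2 bilin_pbul bilin_sh] ..
  finally have *: "D fscale tens2 (pbul (W u) (W v)) = cut (\<lambda>a1 a2. tens2 (W a1) (pbul (W a2) (W v))) u +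
    cut (\<lambda>a1 a2. cut (\<lambda>b1 b2. tens2 (pbul (W a1) (W b1)) (sh (W a2) (W b2))) v) u" .
  obtain F where F: "lin fscale t F" "\<And>x y. F (tens2 x y) = g x y" "\<And>p. F (D fscale tens2 p) = D t g p"
    using tensor_square_lift[OF t g] by blast
  have "F (x + y) = F x + F y" for x y
    using F(1) by (simp add: linear_on_def)
  with arg_cong[OF *, of F] show ?thesis
    by (simp only: cut_linear[OF F(1)] F(2,3))
qed

text \<open>Degrees exclude a constant term unless the word lengths add up to one, which leaves x .
  1. There the counit, applied to both factors in the coproduct formula, makes the constant term
  equal to twice itself.\<close>

lemma eps_pbul: "u \<noteq> [] \<Longrightarrow> eps (pbul (W u) (W v)) = 0"
proof (cases "\<exists>x. u = [x] \<and> v = []")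
  case True
  then obtain x where [simp]: "u = [x]" "v = []" by blast
  have b2: "bilin (*) (\<lambda>p q. eps p * eps q)"
    by (rule bilinI) (auto simp: linear_on_def eps_add eps_scale algebra_simps)
  have "D (*) (\<lambda>p q. eps p * eps q) = eps"
  proof (rule words_ext[OF vector_space_mult])
    show "D (*) (\<lambda>p q. eps p * eps q) (W w) = eps (W w)" for w
      by (simp add: D_W[OF vector_space_mult b2] eps_W cut_left)
  qed (auto simp: tlin_D[OF vector_space_mult b2], simp add: tlin_def lin_eps)
  then have "eps (pbul (W [x]) (W [])) = eps (pbul (W [x]) (W [])) + eps (pbul (W [x]) (W []))"
    using D_pbul_W[OF vector_space_mult b2, of "[x]" "[]"] by (simp add: pbul_one eps_W bilin_zero[OF b2])
  then show ?thesis by simp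
next
  case False
  assume "u \<noteq> []"
  with False have "length u + length v \<noteq> 1" by (cases u; cases "tl u"; cases v) auto
  then show ?thesis
    by (intro pbul_degree[OF vector_space_mult lin_eps]) (auto simp: eps_W)
qed

text \<open>By homogeneity both products lie in degree one, the copy of V in T(V);
  \<open>letter\<close> returns the vector.\<close>

definition star where "star x y = letter (pbul (W [x]) (W [y]))"
definition brk where "brk x y = letter (pbul (W [x, y]) (W []))"

sublocale P: tensor_words_products s star brk
proof unfold_locales
  note lin = lin_compose[OF lin_letter] bilin_lin1[OF bilin_pbul] bilin_lin2[OF bilin_pbul]
  show "bilinear_product s UNIV star"
    unfolding bilinear_product_def star_def
    using multilin_lin[OF multilin_W, of "[]" "[]"] by (auto intro!: lin)
  show "bilinear_product s UNIV brk"
    unfolding bilinear_product_def brk_def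
    using multilin_lin[OF multilin_W, of "[]" "[_]"] multilin_lin[OF multilin_W, of "[_]" "[]"]
    by (auto intro!: lin)
qed

lemma pbul_Cons:
  "pbul (W (x # u)) (W v) = L x (pbul (W u) (W v)) + G (star x) (W v) (W u) + G (brk x) (W u) (W v)"
proof -
  define g where "g = (\<lambda>p q. L (letter p) q)"
  define h where "h a = (\<lambda>a1 a2. cut (\<lambda>b1 b2. g (pbul (W (a @ a1)) (W b1)) (sh (W a2) (W b2))) v)" for a
  have g: "bilin fscale g" unfolding g_def by (rule bilin_first_letter)
  have g0: "g p q = 0" if "letter p = 0" for p q
    using that by (simp add: g_def)
  have long: "h [x] (z # w) a2 = cut (\<lambda>b1 b2. g (pbul (W (x # z # w)) (W b1)) (sh (W a2) (W b2))) v" for z w a2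
    by (simp add: h_def)
  \<comment> \<open>Only the left part \<open>[x]\<close> survives \<open>letter\<close>.\<close>
  have 1: "cut (\<lambda>a1 a2. g (W a1) (pbul (W a2) (W v))) (x # u) = L x (pbul (W u) (W v))"
    by (simp add: g_def letter_W cut_left tproj_id)
  \<comment> \<open>The product of \<open>[x]\<close> with \<open>b1\<close> has the degree of
    \<open>b1\<close>, so \<open>letter\<close> leaves only those \<open>b1\<close> that consist of
    one letter.\<close>
  have 2: "cut (\<lambda>b1 b2. g (pbul (W [x]) (W b1)) (sh p (W b2))) v = G (star x) (W v) p" for p
  proof (cases v)
    case Nil
    then show ?thesis by (simp add: g0 letter_pbul G_one[OF P.lin_star(1)])
  next
    case (Cons y v')
    have "cut (\<lambda>b1 b2. g (pbul (W [x]) (W (y # b1))) (sh p (W b2))) v' = g (pbul (W [x]) (W [y])) (sh p (W v'))"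
      by (rule cut_left) (simp add: g0 letter_pbul)
    then show ?thesis
      by (simp add: Cons g0 letter_pbul W_Cons[of y v'] G_L[OF P.lin_star(1)])
        (simp add: g_def star_def sh_commute)
  qed
  \<comment> \<open>With two letters on the left, only \<open>b1 = []\<close> gives degree
    one.\<close>
  have 3: "cut (\<lambda>b1 b2. g (pbul (W [x, z]) (W b1)) (sh p (W b2))) v = L (brk x z) (sh p (W v))" for z p
  proof -
    have "cut (\<lambda>b1 b2. g (pbul (W [x, z]) (W b1)) (sh p (W b2))) v = g (pbul (W [x, z]) (W [])) (sh p (W v))"
      by (rule cut_left) (simp add: g0 letter_pbul)
    then show ?thesis by (simp add: g_def brk_def)
  qed
  \<comment> \<open>Three or more letters on the left give degree at least two, whatever
    \<open>b1\<close> is.\<close>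
  have 4: "cut (\<lambda>b1 b2. g (pbul (W (x # z # w # w')) (W b1)) (sh p (W b2))) v = 0" for z w w' p
  proof -
    have "(\<lambda>b1 b2. g (pbul (W (x # z # w # w')) (W b1)) (sh p (W b2))) = (\<lambda>_ _. 0)"
      by (simp add: fun_eq_iff g0 letter_pbul)
    then show ?thesis by (simp only: cut_zero)
  qed
  have 5: "cut (\<lambda>a1 a2. cut (\<lambda>b1 b2. g (pbul (W (x # a1)) (W b1)) (sh (W a2) (W b2))) v) u =
    G (star x) (W v) (W u) + G (brk x) (W u) (W v)"
  proof (cases u)
    case Nil
    then show ?thesis by (simp add: 2 G_one[OF P.lin_brk(1)])
  next
    case (Cons z u')
    have "cut (\<lambda>a1 a2. cut (\<lambda>b1 b2. g (pbul (W (x # z # a1)) (W b1)) (sh (W a2) (W b2))) v) u' =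
      cut (\<lambda>b1 b2. g (pbul (W (x # z # [])) (W b1)) (sh (W u') (W b2))) v"
      by (rule cut_left) (rule 4)
    then show ?thesis
      by (simp only: Cons cut.simps 2 3) (simp add: W_Cons[of z u'] G_L[OF P.lin_brk(1)])
  qed
  have "cut (\<lambda>a1 a2. cut (\<lambda>b1 b2. g (pbul (W a1) (W b1)) (sh (W a2) (W b2))) v) (x # u) =
    G (star x) (W v) (W u) + G (brk x) (W u) (W v)"
    by (simp add: pbul_one bilin_zero[OF g] cut_zero 5)
  \<comment> \<open>By \<open>eps_pbul\<close> there is no constant term, so the expansion by first
    letters is the whole product.\<close>
  moreover have "pbul (W (x # u)) (W v) = D fscale g (pbul (W (x # u)) (W v))"
    using first_letter_expansion[of "pbul (W (x # u)) (W v)"] by (simp add: tproj_id eps_pbul g_def)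
  ultimately show ?thesis
    by (simp only: D_pbul_W[OF vsf g] 1 add.assoc)
qed

lemma pbul_eq_bu: "pbul = P.bu"
proof -
  have w: "pbul (W u) (W v) = P.bu (W u) (W v)" for u v
    by (induction u) (simp_all add: pbul_one pbul_Cons[unfolded W_Cons] W_Cons P.bu_L)
  note lin = bilin_lin1[OF bilin_pbul] bilin_lin2[OF bilin_pbul] P.lin_bu1 P.lin_bu2 lin_id
  have 1: "(\<lambda>p. pbul p (W v)) = (\<lambda>p. P.bu p (W v))" for v
    by (rule words_ext[OF vsf]) (auto simp: tlin_def w bilin_tproj[OF bilin_pbul] intro!: lin)
  have 2: "pbul p = P.bu p" for p
    by (rule words_ext[OF vsf])
      (auto simp: tlin_def fun_cong[OF 1] bilin_tproj[OF bilin_pbul] intro!: lin)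
  show ?thesis by (rule HOL.ext) (rule 2)
qed

lemma bul_eq: "p \<in> TV s \<Longrightarrow> q \<in> TV s \<Longrightarrow> bul p q = P.bu p q"
  by (simp add: pbul_eq_bu[symmetric] pbul_def tproj_id)

lemma compatible: "compatible_products s star brk"
proof -
  note comp = P.bu_L G_L[OF P.lin_star(1)] G_L[OF P.lin_brk(1)] G_one[OF P.lin_star(1)]
    G_one[OF P.lin_brk(1)] G_add[OF P.lin_star(1)] G_add[OF P.lin_brk(1)] letter_add letter_zero
    letter_L_one sh_L_L tproj_id W_Cons
  \<comment> \<open>The triples used below have total length three, so both sides have degree one
    and \<open>letter\<close> recovers them as vectors.\<close>
  have prelie: "letter (P.bu (P.bu (W u) (W v)) (W w)) + letter (P.bu (W u) (P.bu (W w) (W v))) =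
      letter (P.bu (P.bu (W u) (W w)) (W v)) + letter (P.bu (W u) (P.bu (W v) (W w)))" for u v w
    using C.prelie[of "W u" "W v" "W w"] unfolding letter_add[symmetric]
    by (simp add: bul_eq algebra_simps)
  show ?thesis
    unfolding compatible_products_def
  proof (intro conjI allI P.bilinear_star P.bilinear_brk)
    fix x y z
    show "star (star x y) z - star x (star y z) = star (star x z) y - star x (star z y)"
      using prelie[of "[x]" "[y]" "[z]"] by (simp add: comp algebra_simps)
    show "star x (brk y z) = brk (star x y) z"
      using prelie[of "[x]" "[y, z]" "[]"] by (simp add: comp)
    show "star (brk x y) z = brk (star x z) y + brk x (star y z) + brk (brk x y) z"
      using prelie[of "[x, y]" "[z]" "[]"] by (simp add: comp add_ac)
    \<comment> \<open>A single letter has product 0 with the unit on the right, so this instance of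
      the Leibniz rule reads {x, y} + {y, x} = 0.\<close>
    have "bul (shuffle_prod s (W [x]) (W [y])) (W []) =
        shuffle_prod s (bul (W [x]) (W [])) (W [y]) + shuffle_prod s (W [x]) (bul (W [y]) (W []))"
      by (rule C.leibniz) simp_all
    then have "letter (P.bu (sh (W [x]) (W [y])) (W [])) =
        letter (sh (P.bu (W [x]) (W [])) (W [y]) + sh (W [x]) (P.bu (W [y]) (W [])))"
      by (simp add: bul_eq sh_eq)
    then show "brk x y = - brk y x"
      by (simp add: comp eq_neg_iff_add_eq_0)
  qed
qed

end

theorem proposition2p6:
  fixes s :: "'k::field_char_0 \<Rightarrow> 'v::ab_group_add \<Rightarrow> 'v"
  assumes "vector_space s"
  shows "(\<forall>star brk. compatible_products s star brk \<longrightarrow>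
      com_prelie_bialgebra fscale (TV s) (shuffle_prod s) (bullet s star brk) (deconc s)) \<and>
    (\<forall>bul. com_prelie_bialgebra fscale (TV s) (shuffle_prod s) bul (deconc s) \<and>
        homogeneous_minus_one s bul \<longrightarrow>
      (\<exists>star brk. compatible_products s star brk \<and>
        (\<forall>t\<in>TV s. \<forall>u\<in>TV s. bul t u = bullet s star brk t u)))"
proof (intro conjI allI impI)
  fix star brk assume c: "compatible_products s star brk"
  have "bilinear_product s UNIV star" "bilinear_product s UNIV brk"
    using c unfolding compatible_products_def by - (elim conjE, assumption)+
  then have "compatible_tensor_words_products s star brk"
    by (intro compatible_tensor_words_products.intro compatible_tensor_words_products_axioms.intro
      tensor_words_products.intro tensor_words_products_axioms.intro tensor_words.intro assms c)
  then show "com_prelie_bialgebra fscale (TV s) (shuffle_prod s) (bullet s star brk) (deconc s)"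
    by (rule compatible_tensor_words_products.com_prelie_bialgebra_bullet)
next
  fix bul
  assume "com_prelie_bialgebra fscale (TV s) (shuffle_prod s) bul (deconc s) \<and> homogeneous_minus_one s bul"
  then interpret H: homogeneous_com_prelie_bialgebra s bul
    by (intro homogeneous_com_prelie_bialgebra.intro homogeneous_com_prelie_bialgebra_axioms.intro
      tensor_words.intro assms) simp_all
  show "\<exists>star brk. compatible_products s star brk \<and>
      (\<forall>t\<in>TV s. \<forall>u\<in>TV s. bul t u = bullet s star brk t u)"
    using H.compatible by (intro exI[of _ H.star] exI[of _ H.brk]) (simp add: H.bul_eq H.P.bu_eq)
qed

end
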